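(* Let $\iota:(\mathfrak{h},\mu_{\mathfrak{h}})\hookrightarrow\mathfrak{g}$ be an injective morphism of finite-dimensional real Lie algebras, and let $(\mathfrak{h}_t,\iota_t)_{t\in I}$ be a smooth deformation of the Lie subalgebra $(\mathfrak{h},\iota)$, where $I\subset\mathbb{R}$ is an open interval containing $0$. Write $\dot\iota_t:=\frac{d}{dt}\iota_t$ and let $\pi^t_{\mathrm{can}}:\mathfrak{g}\to\mathfrak{g}/\iota_t(\mathfrak{h}_t)$ be the canonical projection. Then the following hold. (i) For each $t\in I$, the cochain $\pi^t_{\mathrm{can}}\circ\dot\iota_t\in C^\bullet_{\iota_t}\bigl(\mathfrak{h}_t;\mathfrak{g}/\iota_t(\mathfrak{h}_t)\bigr)$ (a cochain of degree $1$) is a cocycle. (ii) If $(\mathfrak{h}_t,\iota_t)_{t\in I}$ is $\mathrm{Aut}(\mathfrak{g})$-trivial, then there exists a smooth family $(X_t)_{t\in I}\subset Z^1(\mathfrak{g};\mathfrak{g})$ such that $$\pi^t_{\mathrm{can}}\circ\dot\iota_t=\pi^t_{\mathrm{can}}\circ X_t\circ\iota_t\quad\text{for all } t\in I.$$ Conversely, the existence of such a family implies that $(\mathfrak{h}_t,\iota_t)_{t\in I}$ is $\mathrm{Aut}(\mathfrak{g})$-trivial after possibly shrinking $I$.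
   Context: All Lie algebras are finite-dimensional and real; $\mathrm{ad}$ is the adjoint representation of $\mathfrak{g}$, $\mathrm{Aut}(\mathfrak{g})$ its group of Lie algebra automorphisms, and $\mathrm{Hom}$ denotes spaces of linear maps. A smooth family $(s_t)_{t\in I}$ in a finite-dimensional vector space $S$ (or a Lie group) is a smooth curve $t\mapsto s_t$. "After possibly shrinking $I$" means after replacing $I$ by a smaller open interval containing $0$. A smooth deformation $(\mathfrak{h}_t)_{t\in I}=(\mathfrak{h},\mu^t_{\mathfrak{h}})_{t\in I}$ of the Lie algebra $(\mathfrak{h},\mu_{\mathfrak{h}})$ is a smooth family $(\mu^t_{\mathfrak{h}})_{t\in I}\subset\mathrm{Hom}(\wedge^2\mathfrak{h},\mathfrak{h})$ of Lie brackets with $\mu^0_{\mathfrak{h}}=\mu_{\mathfrak{h}}$. A smooth deformation $(\mathfrak{h}_t,\iota_t)_{t\in I}$ of the Lie subalgebra $(\mathfrak{h},\iota)$ consists of a smooth deformation $(\mathfrak{h}_t)_{t\in I}=(\mathfrak{h},\mu^t_{\mathfrak{h}})_{t\in I}$ of the Lie algebra $(\mathfrak{h},\mu_{\mathfrak{h}})$ together with a smooth family $(\iota_t)_{t\in I}\subset\mathrm{Hom}(\mathfrak{h},\mathfrak{g})$ such that $\iota_0=\iota$ and $\iota_t:\mathfrak{h}_t\to\mathfrak{g}$ is an injective Lie algebra morphism for all $t\in I$. It is $\mathrm{Aut}(\mathfrak{g})$-trivial if there exist smooth families $(\psi_t)_{t\in I}\subset\mathrm{GL}(\mathfrak{h})$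 and $(\Psi_t)_{t\in I}\subset\mathrm{Aut}(\mathfrak{g})$ such that $\psi_0=\mathrm{id}_{\mathfrak{h}}$, $\Psi_0=\mathrm{id}_{\mathfrak{g}}$ and, for each $t\in I$, $\psi_t:\mathfrak{h}\to(\mathfrak{h},\mu^t_{\mathfrak{h}})$ is a Lie algebra isomorphism satisfying $\iota_t\circ\psi_t=\Psi_t\circ\iota$. $C^\bullet_{\iota_t}(\mathfrak{h}_t;\mathfrak{g}/\iota_t(\mathfrak{h}_t))$ is the Chevalley–Eilenberg complex of $\mathfrak{h}_t$ with values in $\mathfrak{g}/\iota_t(\mathfrak{h}_t)$ with the representation $u\cdot\pi^t_{\mathrm{can}}(x)=\pi^t_{\mathrm{can}}(\mathrm{ad}_{\iota_t(u)}(x))$ for $u\in\mathfrak{h}$, $x\in\mathfrak{g}$. $Z^1(\mathfrak{g};\mathfrak{g})$ is the space of Chevalley–Eilenberg $1$-cocycles of $\mathfrak{g}$ with values in the adjoint representation, i.e. derivations of $\mathfrak{g}$. *)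

theory Defs
  imports "HOL-Analysis.Analysis"
begin

section \<open>Finite-dimensional real vector spaces\<close>

text \<open>
  Every finite-dimensional real vector space carries a norm, all its norms are equivalent and
  complete, and all linear maps on it are bounded.  So the sort \<open>banach\<close> is no restriction, the
  type \<open>'a \<Rightarrow>\<^sub>L 'b\<close> is the full space of linear maps, and smoothness does not depend on the norm.
  The library class \<open>euclidean_space\<close> is not used because it excludes the zero space.
\<close>

class finite_dim_space = banach +
  assumes finite_dim: "\<exists>B. finite B \<and> (\<forall>x. \<exists>c. x = (\<Sum>b\<in>B. c b *\<^sub>R b))"

instance euclidean_space \<subseteq> finite_dim_space
proof
  show "\<exists>B. finite B \<and> (\<forall>x::'a. \<exists>c. x = (\<Sum>b\<in>B. c b *\<^sub>R b))"
    by (intro exI[of _ Basis] conjI allI finite_Basis,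
        rule_tac x = "\<lambda>b. x \<bullet> b" in exI, simp add: euclidean_representation)
qed

definition open_interval :: "real set \<Rightarrow> bool" where
  "open_interval I \<longleftrightarrow> open I \<and> is_interval I"

text \<open>Infinitely often differentiable curves on an open set; \<open>D n\<close> is the \<open>n\<close>-th derivative.\<close>

definition smooth_family :: "real set \<Rightarrow> (real \<Rightarrow> 'a::real_normed_vector) \<Rightarrow> bool" where
  "smooth_family I c \<longleftrightarrow>
     (\<exists>D :: nat \<Rightarrow> real \<Rightarrow> 'a.
        (\<forall>t\<in>I. D 0 t = c t) \<and>
        (\<forall>n. \<forall>t\<in>I. (D n has_vector_derivative D (Suc n) t) (at t)))"


section \<open>Lie algebras and their morphisms\<close>

text \<open>Bilinearity is part of the type of a bracket.\<close>

type_synonym 'a bracket = "'a \<Rightarrow>\<^sub>L 'a \<Rightarrow>\<^sub>L 'a"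

definition lie_bracket :: "'a::real_normed_vector bracket \<Rightarrow> bool" where
  "lie_bracket \<beta> \<longleftrightarrow>
     (\<forall>x. \<beta> x x = 0) \<and>
     (\<forall>x y z. \<beta> x (\<beta> y z) + \<beta> y (\<beta> z x) + \<beta> z (\<beta> x y) = 0)"

definition lie_hom ::
    "'a::real_normed_vector bracket \<Rightarrow> 'b::real_normed_vector bracket \<Rightarrow> ('a \<Rightarrow>\<^sub>L 'b) \<Rightarrow> bool" where
  "lie_hom \<beta> \<gamma> f \<longleftrightarrow> (\<forall>x y. f (\<beta> x y) = \<gamma> (f x) (f y))"

definition lie_iso ::
    "'a::real_normed_vector bracket \<Rightarrow> 'b::real_normed_vector bracket \<Rightarrow> ('a \<Rightarrow>\<^sub>L 'b) \<Rightarrow> bool" where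
  "lie_iso \<beta> \<gamma> f \<longleftrightarrow> lie_hom \<beta> \<gamma> f \<and> bij (blinfun_apply f)"

definition GL :: "('a::real_normed_vector \<Rightarrow>\<^sub>L 'a) set" where
  "GL = {f. bij (blinfun_apply f)}"

definition lie_Aut :: "'a::real_normed_vector bracket \<Rightarrow> ('a \<Rightarrow>\<^sub>L 'a) set" where
  "lie_Aut \<gamma> = {f. lie_iso \<gamma> \<gamma> f}"


section \<open>The Chevalley--Eilenberg complex\<close>

text \<open>
  The quotients \<open>\<gg>/\<iota>\<^sub>t(\<hh>)\<close> vary with \<open>t\<close>, so modules over a Lie algebra are given by an
  explicit carrier set.
\<close>

record ('h, 'v) lie_module =
  vcarrier :: "'v set"
  vzero :: 'v
  vadd :: "'v \<Rightarrow> 'v \<Rightarrow> 'v"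
  vscale :: "real \<Rightarrow> 'v \<Rightarrow> 'v"
  vact :: "'h \<Rightarrow> 'v \<Rightarrow> 'v"

text \<open>
  A cochain of degree \<open>k\<close> is a function on argument lists; only its values on lists of length \<open>k\<close>
  are relevant.
\<close>

definition CE_cochains ::
    "nat \<Rightarrow> ('h::real_vector, 'v) lie_module \<Rightarrow> ('h list \<Rightarrow> 'v) set" where
  "CE_cochains k V =
     {c. (\<forall>xs. length xs = k \<longrightarrow> c xs \<in> vcarrier V) \<and>
         (\<forall>xs i x y. length xs = k \<and> i < k \<longrightarrow>
            c (xs[i := x + y]) = vadd V (c (xs[i := x])) (c (xs[i := y]))) \<and>
         (\<forall>xs i r x. length xs = k \<and> i < k \<longrightarrow>
            c (xs[i := r *\<^sub>R x]) = vscale V r (c (xs[i := x]))) \<and>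
         (\<forall>xs i j. length xs = k \<and> i < j \<and> j < k \<and> xs ! i = xs ! j \<longrightarrow> c xs = vzero V)}"

definition omit :: "nat set \<Rightarrow> 'a list \<Rightarrow> 'a list" where
  "omit A xs = nths xs (- A)"

text \<open>
  \<open>(\<delta>c)(x\<^sub>0,\<dots>,x\<^sub>k) = (\<Sum>i. (-1)\<^sup>i x\<^sub>i \<cdot> c(\<dots> omit x\<^sub>i \<dots>))
     + (\<Sum>i<j. (-1)\<^sup>i\<^sup>+\<^sup>j c([x\<^sub>i,x\<^sub>j], \<dots> omit x\<^sub>i, x\<^sub>j \<dots>))\<close>, the sum being taken in the module.
\<close>

definition CE_differential ::
    "'h::real_normed_vector bracket \<Rightarrow> ('h, 'v) lie_module \<Rightarrow> ('h list \<Rightarrow> 'v) \<Rightarrow> 'h list \<Rightarrow> 'v" where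
  "CE_differential \<beta> V c xs =
     foldr (vadd V)
       ([vscale V ((-1) ^ i) (vact V (xs ! i) (c (omit {i} xs))). i \<leftarrow> [0..<length xs]] @
        [vscale V ((-1) ^ (i + j)) (c (\<beta> (xs ! i) (xs ! j) # omit {i, j} xs)).
           j \<leftarrow> [0..<length xs], i \<leftarrow> [0..<j]])
       (vzero V)"

definition CE_cocycles ::
    "nat \<Rightarrow> 'h::real_normed_vector bracket \<Rightarrow> ('h, 'v) lie_module \<Rightarrow> ('h list \<Rightarrow> 'v) set" where
  "CE_cocycles k \<beta> V =
     {c \<in> CE_cochains k V. \<forall>xs. length xs = Suc k \<longrightarrow> CE_differential \<beta> V c xs = vzero V}"

text \<open>A map on \<open>\<hh>\<close> viewed as a cochain of degree 1.\<close>

definition cochain1 :: "('h \<Rightarrow> 'v) \<Rightarrow> 'h list \<Rightarrow> 'v" where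
  "cochain1 f xs = f (hd xs)"

definition adjoint_module :: "'a::real_normed_vector bracket \<Rightarrow> ('a, 'a) lie_module" where
  "adjoint_module \<gamma> =
     \<lparr>vcarrier = UNIV, vzero = 0, vadd = (+), vscale = (*\<^sub>R), vact = (\<lambda>x y. \<gamma> x y)\<rparr>"

text \<open>The canonical projection onto the quotient by \<open>W\<close>, whose elements are the cosets of \<open>W\<close>.\<close>

definition quot_proj :: "'a::real_vector set \<Rightarrow> 'a \<Rightarrow> 'a set" where
  "quot_proj W x = x +o W"

text \<open>
  For a morphism \<open>j\<close> from a Lie algebra on \<open>'h\<close> to \<open>(\<gg>, \<gamma>)\<close>, the quotient of \<open>\<gg>\<close> by the image of
  \<open>j\<close>, with the representation \<open>u \<cdot> \<pi>(x) = \<pi>(ad\<^sub>j\<^sub>(\<^sub>u\<^sub>) x)\<close>.  As in \<^theory>\<open>HOL.Equiv_Relations\<close>, an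
  operation on cosets is the union of its values on representatives; these values all agree, see
  the lemmas below.
\<close>

definition quotient_module ::
    "'g::real_normed_vector bracket \<Rightarrow> ('h::real_normed_vector \<Rightarrow>\<^sub>L 'g) \<Rightarrow> ('h, 'g set) lie_module"
  where
  "quotient_module \<gamma> j =
     (let \<pi> = quot_proj (range (blinfun_apply j)) in
       \<lparr>vcarrier = range \<pi>,
        vzero = \<pi> 0,
        vadd = (\<lambda>A B. \<Union>a\<in>A. \<Union>b\<in>B. \<pi> (a + b)),
        vscale = (\<lambda>r A. \<Union>a\<in>A. \<pi> (r *\<^sub>R a)),
        vact = (\<lambda>u A. \<Union>a\<in>A. \<pi> (\<gamma> (j u) a))\<rparr>)"

lemma quot_proj_eq_iff:
  assumes "subspace W"
  shows "quot_proj W x = quot_proj W y \<longleftrightarrow> x - y \<in> W"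
proof
  assume "quot_proj W x = quot_proj W y"
  moreover have "x \<in> quot_proj W x"
    using subspace_0[OF assms] by (force simp: quot_proj_def elt_set_plus_def)
  ultimately show "x - y \<in> W"
    by (auto simp: quot_proj_def elt_set_plus_def)
next
  assume d: "x - y \<in> W"
  have "x + b = y + ((x - y) + b)" "y + b = x + (b - (x - y))" for b
    by simp_all
  then show "quot_proj W x = quot_proj W y"
    using subspace_add[OF assms d] subspace_diff[OF assms _ d]
    unfolding quot_proj_def elt_set_plus_def by blast
qed

lemma UN_quot_proj:
  assumes "subspace W" and "\<And>w. w \<in> W \<Longrightarrow> f (x + w) = f x"
  shows "(\<Union>a\<in>quot_proj W x. f a) = f x"
proof -
  have "x \<in> quot_proj W x"
    using subspace_0[OF assms(1)] by (force simp: quot_proj_def elt_set_plus_def)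
  moreover have "f a = f x" if "a \<in> quot_proj W x" for a
    using that assms(2) by (auto simp: quot_proj_def elt_set_plus_def)
  ultimately show ?thesis by blast
qed

lemma subspace_range_blinfun: "subspace (range (blinfun_apply j))"
  by (intro linear_subspace_image subspace_UNIV bounded_linear.linear blinfun.bounded_linear_right)

lemma quotient_module_simps:
  fixes \<gamma> :: "'g::real_normed_vector bracket" and j :: "'h::real_normed_vector \<Rightarrow>\<^sub>L 'g"
  defines "\<pi> \<equiv> quot_proj (range (blinfun_apply j))"
  shows "vcarrier (quotient_module \<gamma> j) = range \<pi>"
    and "vzero (quotient_module \<gamma> j) = \<pi> 0"
    and "vadd (quotient_module \<gamma> j) (\<pi> x) (\<pi> y) = \<pi> (x + y)"
    and "vscale (quotient_module \<gamma> j) r (\<pi> x) = \<pi> (r *\<^sub>R x)"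
proof -
  note S = subspace_range_blinfun[of j]
  show "vcarrier (quotient_module \<gamma> j) = range \<pi>" "vzero (quotient_module \<gamma> j) = \<pi> 0"
    by (simp_all add: quotient_module_def \<pi>_def Let_def)
  have 1: "(\<Union>b\<in>\<pi> y. \<pi> (a + b)) = \<pi> (a + y)" for a
    unfolding \<pi>_def by (subst UN_quot_proj[OF S]) (simp_all add: quot_proj_eq_iff[OF S])
  have "(\<Union>a\<in>\<pi> x. \<pi> (a + y)) = \<pi> (x + y)"
    unfolding \<pi>_def by (subst UN_quot_proj[OF S]) (simp_all add: quot_proj_eq_iff[OF S])
  with 1 show "vadd (quotient_module \<gamma> j) (\<pi> x) (\<pi> y) = \<pi> (x + y)"
    by (simp add: quotient_module_def Let_def flip: \<pi>_def)
  have "(\<Union>a\<in>\<pi> x. \<pi> (r *\<^sub>R a)) = \<pi> (r *\<^sub>R x)"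
    unfolding \<pi>_def
    by (rule UN_quot_proj[OF S])
      (use subspace_scale[OF S] in \<open>auto simp: quot_proj_eq_iff[OF S] scaleR_add_right\<close>)
  then show "vscale (quotient_module \<gamma> j) r (\<pi> x) = \<pi> (r *\<^sub>R x)"
    by (simp add: quotient_module_def Let_def flip: \<pi>_def)
qed

lemma quotient_module_act:
  fixes \<gamma> :: "'g::real_normed_vector bracket" and j :: "'h::real_normed_vector \<Rightarrow>\<^sub>L 'g"
  defines "\<pi> \<equiv> quot_proj (range (blinfun_apply j))"
  assumes h: "lie_hom \<beta> \<gamma> j"
  shows "vact (quotient_module \<gamma> j) u (\<pi> x) = \<pi> (\<gamma> (j u) x)"
proof -
  let ?W = "range (blinfun_apply j)"
  note S = subspace_range_blinfun[of j]
  have inv: "\<gamma> (j u) w \<in> ?W" if w: "w \<in> ?W" for w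
  proof -
    obtain v where v: "w = j v" using w by blast
    have "j (\<beta> u v) = \<gamma> (j u) (j v)" using h by (simp add: lie_hom_def)
    then show ?thesis unfolding v by (rule range_eqI[OF sym])
  qed
  have "\<pi> (\<gamma> (j u) (x + w)) = \<pi> (\<gamma> (j u) x)" if "w \<in> ?W" for w
    using inv[OF that] unfolding \<pi>_def quot_proj_eq_iff[OF S] blinfun.add_right
    by (simp only: add_diff_cancel_left')
  then have "(\<Union>a\<in>\<pi> x. \<pi> (\<gamma> (j u) a)) = \<pi> (\<gamma> (j u) x)"
    unfolding \<pi>_def by (rule UN_quot_proj[OF S])
  then show "vact (quotient_module \<gamma> j) u (\<pi> x) = \<pi> (\<gamma> (j u) x)"
    by (simp add: quotient_module_def Let_def flip: \<pi>_def)
qed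

lemma derivation_iff_cocycle:
  fixes \<gamma> :: "'g::real_normed_vector bracket" and X :: "'g \<Rightarrow>\<^sub>L 'g"
  assumes "lie_bracket \<gamma>"
  shows "cochain1 (blinfun_apply X) \<in> CE_cocycles 1 \<gamma> (adjoint_module \<gamma>) \<longleftrightarrow>
    (\<forall>x y. X (\<gamma> x y) = \<gamma> (X x) y + \<gamma> x (X y))"
proof -
  have anti: "\<gamma> (X x) y = - \<gamma> y (X x)" for x y
  proof -
    have "\<gamma> (X x + y) (X x + y) = 0" "\<gamma> y y = 0" "\<gamma> (X x) (X x) = 0"
      using assms by (auto simp: lie_bracket_def)
    then show ?thesis
      by (simp add: blinfun.add_left blinfun.add_right eq_neg_iff_add_eq_0 add.commute)
  qed
  have "cochain1 (blinfun_apply X) \<in> CE_cochains 1 (adjoint_module \<gamma>)"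
    by (auto simp: CE_cochains_def cochain1_def adjoint_module_def length_Suc_conv
        blinfun.add_right blinfun.scaleR_right)
  moreover have "CE_differential \<gamma> (adjoint_module \<gamma>) (cochain1 (blinfun_apply X)) [x, y] =
      \<gamma> x (X y) - \<gamma> y (X x) - X (\<gamma> x y)" for x y
    by (simp add: CE_differential_def adjoint_module_def cochain1_def omit_def nths_Cons)
  moreover have "(\<forall>xs :: 'g list. length xs = Suc 1 \<longrightarrow> P xs) \<longleftrightarrow> (\<forall>x y. P [x, y])" for P
    by (auto simp: length_Suc_conv)
  ultimately have "cochain1 (blinfun_apply X) \<in> CE_cocycles 1 \<gamma> (adjoint_module \<gamma>) \<longleftrightarrow>
      (\<forall>x y. \<gamma> x (X y) - \<gamma> y (X x) - X (\<gamma> x y) = 0)"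
    unfolding CE_cocycles_def mem_Collect_eq by (simp add: adjoint_module_def)
  moreover have "a - b - c = 0 \<longleftrightarrow> c = - b + a" for a b c :: 'g
    by (auto simp: algebra_simps)
  ultimately show ?thesis
    by (simp only: anti)
qed


section \<open>Smooth deformations\<close>

definition lie_algebra_deformation ::
    "real set \<Rightarrow> 'h::real_normed_vector bracket \<Rightarrow> (real \<Rightarrow> 'h bracket) \<Rightarrow> bool" where
  "lie_algebra_deformation I \<mu> \<mu>t \<longleftrightarrow>
     smooth_family I \<mu>t \<and> (\<forall>t\<in>I. lie_bracket (\<mu>t t)) \<and> \<mu>t 0 = \<mu>"

definition lie_subalgebra_deformation ::
    "real set \<Rightarrow> 'g::real_normed_vector bracket \<Rightarrow> 'h::real_normed_vector bracket \<Rightarrow> ('h \<Rightarrow>\<^sub>L 'g) \<Rightarrow>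
     (real \<Rightarrow> 'h bracket) \<Rightarrow> (real \<Rightarrow> 'h \<Rightarrow>\<^sub>L 'g) \<Rightarrow> bool" where
  "lie_subalgebra_deformation I \<gamma> \<mu> \<iota> \<mu>t \<iota>t \<longleftrightarrow>
     lie_algebra_deformation I \<mu> \<mu>t \<and>
     smooth_family I \<iota>t \<and> \<iota>t 0 = \<iota> \<and>
     (\<forall>t\<in>I. lie_hom (\<mu>t t) \<gamma> (\<iota>t t) \<and> inj (blinfun_apply (\<iota>t t)))"

definition Aut_trivial ::
    "real set \<Rightarrow> 'g::real_normed_vector bracket \<Rightarrow> 'h::real_normed_vector bracket \<Rightarrow> ('h \<Rightarrow>\<^sub>L 'g) \<Rightarrow>
     (real \<Rightarrow> 'h bracket) \<Rightarrow> (real \<Rightarrow> 'h \<Rightarrow>\<^sub>L 'g) \<Rightarrow> bool" where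
  "Aut_trivial I \<gamma> \<mu> \<iota> \<mu>t \<iota>t \<longleftrightarrow>
     (\<exists>(\<psi> :: real \<Rightarrow> 'h \<Rightarrow>\<^sub>L 'h) (\<Psi> :: real \<Rightarrow> 'g \<Rightarrow>\<^sub>L 'g).
        smooth_family I \<psi> \<and> (\<forall>t\<in>I. \<psi> t \<in> GL) \<and>
        smooth_family I \<Psi> \<and> (\<forall>t\<in>I. \<Psi> t \<in> lie_Aut \<gamma>) \<and>
        \<psi> 0 = id_blinfun \<and> \<Psi> 0 = id_blinfun \<and>
        (\<forall>t\<in>I. lie_iso \<mu> (\<mu>t t) (\<psi> t) \<and> \<iota>t t o\<^sub>L \<psi> t = \<Psi> t o\<^sub>L \<iota>))"

end

theory Submission
  imports Defs
begin

text \<open>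
  The cocycle condition is the derivative of the morphism property.  Differentiating
  \<open>\<iota>\<^sub>t(\<mu>\<^sub>t(x,y)) = \<gamma>(\<iota>\<^sub>t x, \<iota>\<^sub>t y)\<close> gives
  \<open>\<iota>\<^sub>t(\<mu>'\<^sub>t(x,y)) + \<iota>'\<^sub>t(\<mu>\<^sub>t(x,y)) = \<gamma>(\<iota>\<^sub>t x, \<iota>'\<^sub>t y) + \<gamma>(\<iota>'\<^sub>t x, \<iota>\<^sub>t y)\<close>
  (\<open>derivative_of_lie_homs\<close>); the first term dies in \<open>\<gg>/\<iota>\<^sub>t(\<hh>)\<close>, and what remains says that the
  differential of \<open>\<pi>\<^sub>t \<circ> \<iota>'\<^sub>t\<close> vanishes (\<open>cochain1_quotient_cocycle_iff\<close>).

  If \<open>\<iota>\<^sub>t \<circ> \<psi>\<^sub>t = \<Psi>\<^sub>t \<circ> \<iota>\<close> with automorphisms \<open>\<Psi>\<^sub>t\<close>, the logarithmic derivative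
  \<open>X\<^sub>t = \<Psi>'\<^sub>t \<circ> \<Psi>\<^sub>t\<^sup>-\<^sup>1\<close> is a derivation of \<open>\<gg>\<close>, and differentiating the relation gives
  \<open>\<iota>'\<^sub>t \<circ> \<psi>\<^sub>t = X\<^sub>t \<circ> \<iota>\<^sub>t \<circ> \<psi>\<^sub>t - \<iota>\<^sub>t \<circ> \<psi>'\<^sub>t\<close>.  Since \<open>\<psi>\<^sub>t\<close> is onto, \<open>\<iota>'\<^sub>t\<close> and \<open>X\<^sub>t \<circ> \<iota>\<^sub>t\<close> agree
  modulo the image of \<open>\<iota>\<^sub>t\<close> (\<open>Aut_trivial_imp_derivations\<close>).

  Conversely, let \<open>X\<^sub>t\<close> be derivations with \<open>\<iota>'\<^sub>t = X\<^sub>t \<circ> \<iota>\<^sub>t\<close> modulo the image of \<open>\<iota>\<^sub>t\<close>.  Then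
  \<open>X\<^sub>t \<circ> \<iota>\<^sub>t - \<iota>'\<^sub>t = \<iota>\<^sub>t \<circ> \<theta>\<^sub>t\<close> for a unique \<open>\<theta>\<^sub>t\<close>, which is smooth near \<open>0\<close> because \<open>\<iota>\<^sub>t\<close> has a smooth
  family of left inverses there.  Let \<open>\<Psi>\<close> and \<open>\<psi>\<close> solve \<open>\<Psi>' = X \<circ> \<Psi>\<close> and \<open>\<psi>' = \<theta> \<circ> \<psi>\<close> with identity as
  initial value.  The curves \<open>\<iota>\<^sub>t \<circ> \<psi>\<^sub>t\<close> and \<open>\<Psi>\<^sub>t \<circ> \<iota>\<close> both solve \<open>y' = X\<^sub>t \<circ> y\<close> with \<open>y(0) = \<iota>\<close>, hence
  coincide.  The defect \<open>\<Psi>\<^sub>t(\<gamma>(x,y)) - \<gamma>(\<Psi>\<^sub>t x, \<Psi>\<^sub>t y)\<close> solves \<open>w' = X\<^sub>t w\<close> with \<open>w(0) = 0\<close>, hence \<open>\<Psi>\<^sub>t\<close>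
  preserves the bracket (\<open>derivation_flow_lie_hom\<close>).  That \<open>\<psi>\<^sub>t\<close> is a morphism follows, because \<open>\<iota>\<^sub>t\<close> is
  injective (\<open>derivations_imp_Aut_trivial\<close>).

  Three analytic facts carry the argument: linear maps on a finite-dimensional normed space are
  bounded (\<open>linear_imp_bounded_linear\<close>), which provides left inverses and inverses as bounded
  operators; pointwise inversion preserves smoothness (\<open>smooth_family_inverse\<close>); and linear
  differential equations have local solutions that are unique (\<open>linear_ODE_solution_exists\<close>,
  \<open>linear_ODE_solution_unique\<close>) and smooth (\<open>smooth_family_linear_ODE\<close>).
\<close>

section \<open>Calculus of smooth curves\<close>

lemma has_vector_derivative_unique_on_open:
  assumes "(f has_vector_derivative f') (at t)" "(g has_vector_derivative g') (at t)"
    and "open I" "t \<in> I" "\<And>s. s \<in> I \<Longrightarrow> f s = g s"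
  shows "f' = g'"
  using has_vector_derivative_transform_within_open[OF assms(1,3-5)] assms(2)
  by (rule vector_derivative_unique_at)

lemma has_vector_derivative_blinfun_apply_const:
  "(F has_vector_derivative F') (at t) \<Longrightarrow> ((\<lambda>s. blinfun_apply (F s) x) has_vector_derivative F' x) (at t)"
  using blinfun.has_vector_derivative[OF _ has_vector_derivative_const] by fastforce

text \<open>
  Curves with \<open>n\<close> successive derivatives.  A curve on an open set is smooth iff it lies in every
  \<open>C_diff n\<close>, so that smoothness of products, inverses and solutions of differential equations
  follows by induction on \<open>n\<close>, without formulas for higher derivatives.
\<close>

primrec C_diff :: "nat \<Rightarrow> real set \<Rightarrow> (real \<Rightarrow> 'a::real_normed_vector) \<Rightarrow> bool" where
  "C_diff 0 I c \<longleftrightarrow> True"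
| "C_diff (Suc n) I c \<longleftrightarrow>
     (\<exists>c'. (\<forall>t\<in>I. (c has_vector_derivative c' t) (at t)) \<and> C_diff n I c')"

lemma C_diff_cong:
  assumes "open I" "\<And>t. t \<in> I \<Longrightarrow> c t = d t" "C_diff n I c"
  shows "C_diff n I d"
proof (cases n)
  case (Suc m)
  then obtain c' where c': "\<And>t. t \<in> I \<Longrightarrow> (c has_vector_derivative c' t) (at t)" "C_diff m I c'"
    using assms(3) by auto
  have "(d has_vector_derivative c' t) (at t)" if "t \<in> I" for t
    using has_vector_derivative_transform_within_open[OF c'(1)[OF that] assms(1) that assms(2)] .
  then show ?thesis using c'(2) Suc by auto
qed simp

lemma C_diff_SucD: "C_diff (Suc n) I c \<Longrightarrow> C_diff n I c"
  by (induction n arbitrary: c) auto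

lemma smooth_family_iff_C_diff:
  assumes "open I"
  shows "smooth_family I c \<longleftrightarrow> (\<forall>n. C_diff n I c)"
proof
  assume "smooth_family I c"
  then obtain D where D0: "\<And>t. t \<in> I \<Longrightarrow> D 0 t = c t"
    and D: "\<And>n t. t \<in> I \<Longrightarrow> (D n has_vector_derivative D (Suc n) t) (at t)"
    unfolding smooth_family_def by blast
  have "C_diff n I (D k)" for n k
    by (induction n arbitrary: k) (use D in auto)
  then show "\<forall>n. C_diff n I c"
    by (auto intro: C_diff_cong[OF assms D0])
next
  assume c: "\<forall>n. C_diff n I c"
  let ?d = "\<lambda>f t. vector_derivative f (at t)"
  have step: "C_diff n I (?d f)" if f: "C_diff (Suc n) I f" for n and f :: "real \<Rightarrow> 'a"
  proof -
    obtain f' where f': "\<And>t. t \<in> I \<Longrightarrow> (f has_vector_derivative f' t) (at t)" "C_diff n I f'"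
      using f by auto
    show ?thesis
      by (rule C_diff_cong[OF assms _ f'(2)]) (rule vector_derivative_at[OF f'(1), symmetric])
  qed
  define D where "D n = (?d ^^ n) c" for n
  have Ck: "C_diff m I (D n)" for m n
    by (induction n arbitrary: m) (use c step in \<open>auto simp: D_def simp del: C_diff.simps\<close>)
  have "(D n has_vector_derivative D (Suc n) t) (at t)" if "t \<in> I" for n t
    using Ck[of "Suc 0" n] that by (auto simp: D_def vector_derivative_at)
  moreover have "D 0 t = c t" for t by (simp add: D_def)
  ultimately show "smooth_family I c"
    unfolding smooth_family_def by blast
qed

lemma smooth_family_subset: "smooth_family I c \<Longrightarrow> J \<subseteq> I \<Longrightarrow> smooth_family J c"
  unfolding smooth_family_def by blast

lemma smooth_family_has_vector_derivative:
  assumes "open I" "smooth_family I c" "t \<in> I"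
  shows "(c has_vector_derivative vector_derivative c (at t)) (at t)"
proof -
  have "C_diff (Suc 0) I c"
    using smooth_family_iff_C_diff[OF assms(1)] assms(2) by blast
  then show ?thesis using assms(3) by (auto simp: vector_derivative_at)
qed

lemma smooth_family_vector_derivative:
  assumes "open I" "smooth_family I c"
  shows "smooth_family I (\<lambda>t. vector_derivative c (at t))"
  unfolding smooth_family_iff_C_diff[OF assms(1)]
proof
  fix n
  have "C_diff (Suc n) I c"
    using smooth_family_iff_C_diff[OF assms(1)] assms(2) by blast
  then obtain c' where c': "\<And>t. t \<in> I \<Longrightarrow> (c has_vector_derivative c' t) (at t)" "C_diff n I c'"
    by auto
  show "C_diff n I (\<lambda>t. vector_derivative c (at t))"
    by (rule C_diff_cong[OF assms(1) _ c'(2)]) (rule vector_derivative_at[OF c'(1), symmetric])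
qed

lemma smooth_family_continuous_on:
  assumes "open I" "smooth_family I c"
  shows "continuous_on I c"
  using smooth_family_has_vector_derivative[OF assms]
  by (meson continuous_at_imp_continuous_on has_vector_derivative_continuous)

lemma C_diff_const: "C_diff n I (\<lambda>t. a)"
  by (induction n arbitrary: a) (auto intro!: exI[of _ "\<lambda>t. 0"])

lemma smooth_family_const: "open I \<Longrightarrow> smooth_family I (\<lambda>t. a)"
  by (simp add: smooth_family_iff_C_diff C_diff_const)

lemma C_diff_add: "C_diff n I f \<Longrightarrow> C_diff n I g \<Longrightarrow> C_diff n I (\<lambda>t. f t + g t)"
proof (induction n arbitrary: f g)
  case (Suc n)
  then obtain f' g' where "\<forall>t\<in>I. (f has_vector_derivative f' t) (at t)" "C_diff n I f'"
    "\<forall>t\<in>I. (g has_vector_derivative g' t) (at t)" "C_diff n I g'" by auto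
  then show ?case
    using Suc.IH by (auto intro!: exI[of _ "\<lambda>t. f' t + g' t"] has_vector_derivative_add)
qed simp

lemma (in bounded_linear) C_diff_compose: "C_diff n I g \<Longrightarrow> C_diff n I (\<lambda>t. f (g t))"
proof (induction n arbitrary: g)
  case (Suc n)
  then obtain g' where "\<forall>t\<in>I. (g has_vector_derivative g' t) (at t)" "C_diff n I g'" by auto
  then show ?case
    using Suc.IH by (auto intro!: exI[of _ "\<lambda>t. f (g' t)"] has_vector_derivative)
qed simp

lemma smooth_family_diff:
  assumes "open I" "smooth_family I f" "smooth_family I g"
  shows "smooth_family I (\<lambda>t. f t - g t)"
proof -
  have "C_diff n I (\<lambda>t. f t + (- g t))" for n
    using assms by (intro C_diff_add bounded_linear.C_diff_compose[OF bounded_linear_minus[OF bounded_linear_ident]])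
      (simp_all add: smooth_family_iff_C_diff)
  then show ?thesis by (simp add: smooth_family_iff_C_diff[OF assms(1)])
qed

context bounded_bilinear
begin

lemma C_diff_prod: "C_diff n I f \<Longrightarrow> C_diff n I g \<Longrightarrow> C_diff n I (\<lambda>t. prod (f t) (g t))"
proof (induction n arbitrary: f g)
  case (Suc n)
  then obtain f' g' where *: "\<forall>t\<in>I. (f has_vector_derivative f' t) (at t)" "C_diff n I f'"
    "\<forall>t\<in>I. (g has_vector_derivative g' t) (at t)" "C_diff n I g'" by auto
  have "C_diff n I f" "C_diff n I g"
    using Suc.prems C_diff_SucD by blast+
  then have "C_diff n I (\<lambda>t. prod (f t) (g' t) + prod (f' t) (g t))"
    using * Suc.IH by (intro C_diff_add) auto
  then show ?case
    using * by (auto intro!: exI[of _ "\<lambda>t. prod (f t) (g' t) + prod (f' t) (g t)"]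
        has_vector_derivative)
qed simp

lemma smooth_family_prod:
  "open I \<Longrightarrow> smooth_family I f \<Longrightarrow> smooth_family I g \<Longrightarrow> smooth_family I (\<lambda>t. prod (f t) (g t))"
  by (simp add: smooth_family_iff_C_diff C_diff_prod)

end

text \<open>
  Bootstrapping: if \<open>y\<close> has \<open>n\<close> derivatives, so does the right-hand side, which is \<open>y'\<close>.
\<close>

lemma smooth_family_linear_ODE:
  assumes "open I" "bounded_bilinear p" "smooth_family I A"
    and y: "\<And>t. t \<in> I \<Longrightarrow> (y has_vector_derivative p (A t) (y t)) (at t)"
  shows "smooth_family I y"
  unfolding smooth_family_iff_C_diff[OF assms(1)]
proof
  fix n
  show "C_diff n I y"
  proof (induction n)
    case (Suc n)
    have "C_diff n I (\<lambda>t. p (A t) (y t))"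
      using assms(1,3) Suc by (intro bounded_bilinear.C_diff_prod[OF assms(2)])
        (auto simp: smooth_family_iff_C_diff)
    then show ?case using y by (auto intro!: exI[of _ "\<lambda>t. p (A t) (y t)"])
  qed simp
qed

lemmas smooth_family_blinfun_compose =
  bounded_bilinear.smooth_family_prod[OF bounded_bilinear_blinfun_compose]

section \<open>Linear maps on finite-dimensional spaces\<close>

text \<open>
  Closed balls need not be compact at this level of generality, but the combinations of finitely
  many vectors with coefficients in a compact interval are, as sums of compact segments.  This is
  the compactness behind the next lemma.
\<close>

lemma compact_combinations:
  fixes B :: "'a::real_normed_vector set"
  assumes "finite B"
  shows "compact {\<Sum>b\<in>B. u b *\<^sub>R b | u. \<forall>b\<in>B. \<bar>u b\<bar> \<le> (R::real)}"
  using assms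
proof (induction rule: finite_induct)
  case empty
  then show ?case by simp
next
  case (insert a B)
  let ?K = "{\<Sum>b\<in>B. u b *\<^sub>R b | u. \<forall>b\<in>B. \<bar>u b\<bar> \<le> R}"
  have "compact ((\<lambda>r. r *\<^sub>R a) ` {-R..R})"
    by (intro compact_continuous_image continuous_intros) auto
  then have "compact {x + y | x y. x \<in> (\<lambda>r. r *\<^sub>R a) ` {-R..R} \<and> y \<in> ?K}"
    using insert.IH by (rule compact_sums)
  also have "{x + y | x y. x \<in> (\<lambda>r. r *\<^sub>R a) ` {-R..R} \<and> y \<in> ?K} =
    {\<Sum>b\<in>insert a B. u b *\<^sub>R b | u. \<forall>b\<in>insert a B. \<bar>u b\<bar> \<le> R}"
  proof (intro equalityI subsetI)
    fix z assume "z \<in> {x + y | x y. x \<in> (\<lambda>r. r *\<^sub>R a) ` {-R..R} \<and> y \<in> ?K}"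
    then obtain r u where z: "z = r *\<^sub>R a + (\<Sum>b\<in>B. u b *\<^sub>R b)" "\<bar>r\<bar> \<le> R" "\<forall>b\<in>B. \<bar>u b\<bar> \<le> R"
      by (auto simp: abs_le_iff)
    have "(\<Sum>b\<in>B. (u(a := r)) b *\<^sub>R b) = (\<Sum>b\<in>B. u b *\<^sub>R b)"
      using insert.hyps by (intro sum.cong) auto
    then show "z \<in> {\<Sum>b\<in>insert a B. u b *\<^sub>R b | u. \<forall>b\<in>insert a B. \<bar>u b\<bar> \<le> R}"
      using insert.hyps z by (intro CollectI exI[of _ "u(a := r)"]) auto
  next
    fix z assume "z \<in> {\<Sum>b\<in>insert a B. u b *\<^sub>R b | u. \<forall>b\<in>insert a B. \<bar>u b\<bar> \<le> R}"
    then obtain u where u: "z = (\<Sum>b\<in>insert a B. u b *\<^sub>R b)" "\<forall>b\<in>insert a B. \<bar>u b\<bar> \<le> R" by blast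
    then have "z = u a *\<^sub>R a + (\<Sum>b\<in>B. u b *\<^sub>R b)" "u a \<in> {-R..R}"
      using insert.hyps by (auto simp: abs_le_iff)
    then show "z \<in> {x + y | x y. x \<in> (\<lambda>r. r *\<^sub>R a) ` {-R..R} \<and> y \<in> ?K}"
      using u(2) by blast
  qed
  finally show ?case .
qed

text \<open>
  Coordinates depend continuously on the vector.  By induction on \<open>B\<close>: a new vector \<open>a\<close> has positive
  distance \<open>d\<close> from the span of \<open>B\<close>, since the vectors of the span that are close to \<open>a\<close> have bounded
  coefficients by the induction hypothesis, hence lie in a compact set not containing \<open>a\<close>.  So the
  coefficient of \<open>a\<close> in \<open>x\<close> is at most \<open>norm x / d\<close>, which also controls the part of \<open>x\<close> in the span
  of \<open>B\<close>.
\<close>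

lemma independent_coeff_bounded:
  fixes B :: "'a::real_normed_vector set"
  assumes "finite B" "independent B"
  shows "\<exists>C. \<forall>u. \<forall>b\<in>B. \<bar>u b\<bar> \<le> C * norm (\<Sum>b\<in>B. u b *\<^sub>R b)"
  using assms
proof (induction rule: finite_induct)
  case (insert a B)
  then have a: "a \<notin> span B" and "independent B"
    by (auto simp: independent_insert)
  then obtain C where C: "\<And>u b. b \<in> B \<Longrightarrow> \<bar>u b\<bar> \<le> C * norm (\<Sum>b\<in>B. u b *\<^sub>R b)"
    using insert.IH by blast
  \<comment> \<open>vectors of the span at distance at most \<open>1\<close> from \<open>a\<close> have coefficients bounded by \<open>R\<close>\<close>
  define R where "R = \<bar>C\<bar> * (norm a + 1)"
  let ?K = "{\<Sum>b\<in>B. u b *\<^sub>R b | u. \<forall>b\<in>B. \<bar>u b\<bar> \<le> R}"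
  have "?K \<subseteq> span B"
    by (auto intro!: span_sum span_scale intro: span_base)
  then have a_out: "a \<in> - ?K" using a by blast
  have "open (- ?K)"
    using compact_combinations[OF insert.hyps(1)] by (intro open_Compl compact_imp_closed)
  then obtain e where "e > 0" "ball a e \<subseteq> - ?K"
    using a_out by (rule openE)
  then have e: "e > 0" "\<And>y. y \<in> ?K \<Longrightarrow> e \<le> dist a y"
    by (simp, meson ComplD in_mono mem_ball not_le)
  define d where "d = min e 1"
  have d: "d > 0" "d \<le> 1" "d \<le> e" using e by (auto simp: d_def)
  have dist: "d \<le> norm (a + (\<Sum>b\<in>B. u b *\<^sub>R b))" for u
  proof (rule ccontr)
    assume n: "\<not> ?thesis"
    let ?v = "\<lambda>b. - u b"
    have lt: "dist a (\<Sum>b\<in>B. ?v b *\<^sub>R b) < d"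
      using n by (simp add: dist_norm sum_negf)
    then have "norm (\<Sum>b\<in>B. ?v b *\<^sub>R b) \<le> norm a + 1"
      using d norm_triangle_ineq2[of "\<Sum>b\<in>B. ?v b *\<^sub>R b" a] by (simp add: dist_norm norm_minus_commute)
    moreover have "\<bar>?v b\<bar> \<le> \<bar>C\<bar> * norm (\<Sum>b\<in>B. ?v b *\<^sub>R b)" if "b \<in> B" for b
      using C[OF that, of ?v] by (meson abs_ge_self mult_right_mono norm_ge_zero order_trans)
    ultimately have "\<forall>b\<in>B. \<bar>?v b\<bar> \<le> R"
      unfolding R_def by (meson abs_ge_zero mult_left_mono order_trans)
    then have "(\<Sum>b\<in>B. ?v b *\<^sub>R b) \<in> ?K" by (intro CollectI exI[of _ ?v] conjI refl)
    then show False using e(2) lt d by force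
  qed
  have ua: "\<bar>u a\<bar> \<le> norm (\<Sum>b\<in>insert a B. u b *\<^sub>R b) / d" for u
  proof (cases "u a = 0")
    case True
    then show ?thesis using d by simp
  next
    case False
    have "(\<Sum>b\<in>insert a B. u b *\<^sub>R b) = u a *\<^sub>R (a + (\<Sum>b\<in>B. (u b / u a) *\<^sub>R b))"
      using insert.hyps False by (simp add: scaleR_add_right scaleR_sum_right)
    then have "norm (\<Sum>b\<in>insert a B. u b *\<^sub>R b) = \<bar>u a\<bar> * norm (a + (\<Sum>b\<in>B. (u b / u a) *\<^sub>R b))"
      by (simp only: norm_scaleR)
    also have "\<dots> \<ge> \<bar>u a\<bar> * d"
      using dist by (intro mult_left_mono) auto
    finally show ?thesis using d by (simp add: field_simps)
  qed
  define C' where "C' = max (1 / d) (\<bar>C\<bar> * (1 + norm a / d))"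
  have "\<bar>u b\<bar> \<le> C' * norm (\<Sum>b\<in>insert a B. u b *\<^sub>R b)" if "b \<in> insert a B" for u b
  proof -
    let ?x = "\<Sum>b\<in>insert a B. u b *\<^sub>R b"
    show ?thesis
    proof (cases "b = a")
      case True
      have "\<bar>u a\<bar> \<le> (1 / d) * norm ?x" using ua[of u] by simp
      also have "\<dots> \<le> C' * norm ?x" unfolding C'_def by (intro mult_right_mono) auto
      finally show ?thesis using True by simp
    next
      case False
      then have "\<bar>u b\<bar> \<le> C * norm (\<Sum>b\<in>B. u b *\<^sub>R b)" using C that by blast
      also have "\<dots> \<le> \<bar>C\<bar> * norm (\<Sum>b\<in>B. u b *\<^sub>R b)" by (intro mult_right_mono) auto
      also have "(\<Sum>b\<in>B. u b *\<^sub>R b) = ?x - u a *\<^sub>R a" using insert.hyps by simp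
      also have "norm (?x - u a *\<^sub>R a) \<le> norm ?x + \<bar>u a\<bar> * norm a"
        by (metis norm_scaleR norm_triangle_ineq4)
      also have "\<dots> \<le> norm ?x + (norm ?x / d) * norm a"
        using ua[of u] by (intro add_left_mono mult_right_mono) auto
      also have "\<dots> = (1 + norm a / d) * norm ?x" by (simp add: algebra_simps)
      finally have "\<bar>u b\<bar> \<le> \<bar>C\<bar> * ((1 + norm a / d) * norm ?x)" by (simp add: mult_left_mono)
      also have "\<dots> \<le> C' * norm ?x" unfolding C'_def mult.assoc[symmetric] by (intro mult_right_mono) auto
      finally show ?thesis .
    qed
  qed
  then show ?case by blast
qed simp

lemma linear_imp_bounded_linear:
  fixes f :: "'a::finite_dim_space \<Rightarrow> 'b::real_normed_vector"
  assumes "linear f"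
  shows "bounded_linear f"
proof -
  obtain B0 :: "'a set" where B0: "finite B0" "\<And>x. \<exists>c. x = (\<Sum>b\<in>B0. c b *\<^sub>R b)"
    using finite_dim by blast
  obtain B where B: "B \<subseteq> B0" "independent B" "B0 \<subseteq> span B"
    using maximal_independent_subset by blast
  have "x \<in> span B" for x
  proof -
    obtain c where "x = (\<Sum>b\<in>B0. c b *\<^sub>R b)" using B0(2) by blast
    then show ?thesis using B(3) by (auto intro!: span_sum span_scale)
  qed
  then have sp: "span B = UNIV" by blast
  have fB: "finite B" using B(1) B0(1) finite_subset by blast
  then obtain C where C: "\<And>u b. b \<in> B \<Longrightarrow> \<bar>u b\<bar> \<le> C * norm (\<Sum>b\<in>B. u b *\<^sub>R b)"
    using independent_coeff_bounded[OF fB B(2)] by metis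
  have "norm (f x) \<le> norm x * (C * (\<Sum>b\<in>B. norm (f b)))" for x
  proof -
    obtain u where x: "x = (\<Sum>b\<in>B. u b *\<^sub>R b)"
      using sp span_finite[OF fB] by blast
    have "f x = (\<Sum>b\<in>B. u b *\<^sub>R f b)"
      by (simp add: x linear_sum[OF assms] linear_scale[OF assms])
    also have "norm \<dots> \<le> (\<Sum>b\<in>B. \<bar>u b\<bar> * norm (f b))"
      by (rule order_trans[OF norm_sum]) simp
    also have "\<dots> \<le> (\<Sum>b\<in>B. C * norm x * norm (f b))"
      using C unfolding x by (intro sum_mono mult_right_mono) auto
    finally show ?thesis by (simp add: sum_distrib_left mult_ac)
  qed
  then show ?thesis
    using assms by (intro bounded_linear_intro[where K = "C * (\<Sum>b\<in>B. norm (f b))"])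
      (auto simp: linear_add linear_scale)
qed

lemma left_inverse_blinfun:
  fixes f :: "'a::real_normed_vector \<Rightarrow>\<^sub>L 'b::finite_dim_space"
  assumes "inj (blinfun_apply f)"
  obtains g where "g o\<^sub>L f = id_blinfun"
proof -
  have "linear (blinfun_apply f)"
    by (intro bounded_linear.linear blinfun.bounded_linear_right)
  then obtain g where g: "linear g" "g \<circ> blinfun_apply f = id"
    using linear_injective_left_inverse assms by blast
  have "blinfun_apply (Blinfun g) = g"
    by (simp add: bounded_linear_Blinfun_apply linear_imp_bounded_linear g(1))
  then have "Blinfun g o\<^sub>L f = id_blinfun"
    using g(2) by (intro blinfun_eqI) (simp add: fun_eq_iff)
  then show thesis by (rule that)
qed

lemma GL_inverse:
  fixes f :: "'a::finite_dim_space \<Rightarrow>\<^sub>L 'a"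
  assumes "f \<in> GL"
  obtains g where "g o\<^sub>L f = id_blinfun" "f o\<^sub>L g = id_blinfun"
proof -
  obtain g where g: "g o\<^sub>L f = id_blinfun"
    using left_inverse_blinfun assms bij_is_inj unfolding GL_def by blast
  then have "g (f x) = x" for x
    by (metis blinfun_apply_blinfun_compose id_blinfun.rep_eq)
  then have "f (g y) = y" for y
    using assms unfolding GL_def mem_Collect_eq bij_iff by metis
  then have "f o\<^sub>L g = id_blinfun" by (intro blinfun_eqI) simp
  with g show thesis by (rule that)
qed

section \<open>Invertible operators\<close>

text \<open>
  Solving \<open>f x = y\<close> means finding a fixed point of \<open>x \<mapsto> y - (f x - x)\<close>, a contraction.
\<close>

lemma GL_near_identity:
  fixes f :: "'a::banach \<Rightarrow>\<^sub>L 'a"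
  assumes "norm (f - id_blinfun) < 1"
  shows "f \<in> GL"
proof -
  have "\<exists>!x. y - (f x - x) = x" for y
  proof (rule banach_fix_type)
    show "0 \<le> norm (f - id_blinfun)" by simp
    show "norm (f - id_blinfun) < 1" by fact
    have "dist (y - (f a - a)) (y - (f b - b)) = norm ((f - id_blinfun) (b - a))" for a b
      by (simp add: dist_norm blinfun.diff_left blinfun.diff_right algebra_simps)
    then show "\<forall>a b. dist (y - (f a - a)) (y - (f b - b)) \<le> norm (f - id_blinfun) * dist a b"
      by (metis dist_commute dist_norm norm_blinfun)
  qed
  then have "\<exists>!x. y = f x" for y by (simp add: algebra_simps)
  then have "\<exists>!x. f x = y" for y by metis
  then show ?thesis by (auto simp: GL_def bij_iff)
qed

lemma GL_near_0:
  assumes "open I" "0 \<in> I" "continuous_on I F" "F (0::real) = id_blinfun"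
  obtains e where "e > 0" "\<And>t. \<bar>t\<bar> < e \<Longrightarrow> (F t :: 'a::banach \<Rightarrow>\<^sub>L 'a) \<in> GL"
proof -
  have "isCont F 0"
    using assms continuous_on_eq_continuous_at by blast
  then obtain e where "e > 0" "\<And>t. dist t 0 < e \<Longrightarrow> dist (F t) (F 0) < 1"
    unfolding continuous_at_eps_delta by (metis zero_less_one)
  then show thesis
    by (intro that[of e] GL_near_identity) (auto simp: assms(4) dist_norm)
qed

lemma has_vector_derivative_iff_quotient:
  "(f has_vector_derivative f') (at t) \<longleftrightarrow> ((\<lambda>s. (f s - f t) /\<^sub>R (s - t)) \<longlongrightarrow> f') (at t)"
proof -
  have "norm (f s - f t - (s - t) *\<^sub>R f') / norm (s - t) = norm ((f s - f t) /\<^sub>R (s - t) - f')"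
    if "s \<noteq> t" for s
  proof -
    have "f s - f t - (s - t) *\<^sub>R f' = (s - t) *\<^sub>R ((f s - f t) /\<^sub>R (s - t) - f')"
      using that by (simp add: scaleR_diff_right)
    then have "norm (f s - f t - (s - t) *\<^sub>R f') = norm (s - t) * norm ((f s - f t) /\<^sub>R (s - t) - f')"
      by (simp only: norm_scaleR real_norm_def)
    then show ?thesis using that by simp
  qed
  then have "((\<lambda>s. norm (f s - f t - (s - t) *\<^sub>R f') / norm (s - t)) \<longlongrightarrow> 0) (at t) \<longleftrightarrow>
      ((\<lambda>s. norm ((f s - f t) /\<^sub>R (s - t) - f')) \<longlongrightarrow> 0) (at t)"
    by (intro Lim_cong_within) auto
  then show ?thesis
    by (simp add: has_vector_derivative_def has_derivative_iff_norm bounded_linear_scaleR_left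
        Lim_null[of _ f'] tendsto_norm_zero_iff)
qed

text \<open>
  From \<open>G\<^sub>s - G\<^sub>t = - G\<^sub>s \<circ> (F\<^sub>s - F\<^sub>t) \<circ> G\<^sub>t\<close>: taking norms bounds \<open>G\<^sub>s\<close> near \<open>t\<close>, the bound gives continuity
  of \<open>G\<close> at \<open>t\<close>, and dividing by \<open>s - t\<close> gives the derivative.
\<close>

lemma inverse_has_vector_derivative:
  fixes F :: "real \<Rightarrow> 'a::real_normed_vector \<Rightarrow>\<^sub>L 'b::real_normed_vector"
  assumes inv: "\<And>s. s \<in> I \<Longrightarrow> G s o\<^sub>L F s = id_blinfun" "\<And>s. s \<in> I \<Longrightarrow> F s o\<^sub>L G s = id_blinfun"
    and I: "open I" "t \<in> I" and F: "(F has_vector_derivative F') (at t)"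
  shows "(G has_vector_derivative - (G t o\<^sub>L F' o\<^sub>L G t)) (at t)"
proof -
  have GF: "G s (F s x) = x" "F s (G s y) = y" if "s \<in> I" for s x y
    using inv[OF that] by (metis blinfun_apply_blinfun_compose id_blinfun.rep_eq)+
  have id: "G s - G t = - (G s o\<^sub>L (F s - F t) o\<^sub>L G t)" if "s \<in> I" for s
    by (intro blinfun_eqI) (simp add: blinfun.diff_left blinfun.diff_right blinfun.minus_left GF that I(2))
  have evI: "\<forall>\<^sub>F s in at t. s \<in> I"
    using I by (simp add: eventually_at_in_open')
  have Fc: "(F \<longlongrightarrow> F t) (at t)"
    using has_vector_derivative_continuous[OF F] by (simp add: isCont_def)
  define N where "N = norm (G t)"
  have "((\<lambda>s. norm (F s - F t) * N) \<longlongrightarrow> 0) (at t)"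
    by (rule tendsto_eq_intros Fc refl | simp)+
  then have "\<forall>\<^sub>F s in at t. norm (F s - F t) * N < 1/2"
    by (rule order_tendstoD) simp
  with evI have bound: "\<forall>\<^sub>F s in at t. norm (G s) \<le> 2 * N"
  proof eventually_elim
    case (elim s)
    have "norm (G s) \<le> norm (G t) + norm (G s - G t)"
      by (metis add.commute diff_add_cancel norm_triangle_ineq)
    also have "norm (G s - G t) = norm (G s o\<^sub>L (F s - F t) o\<^sub>L G t)"
      using id[OF elim(1)] by simp
    also have "\<dots> \<le> norm (G s o\<^sub>L (F s - F t)) * norm (G t)" by (rule norm_blinfun_compose)
    also have "\<dots> \<le> norm (G s) * norm (F s - F t) * norm (G t)"
      by (intro mult_right_mono norm_blinfun_compose) simp
    also have "\<dots> \<le> norm (G s) * (1/2)"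
      unfolding mult.assoc using elim(2) by (intro mult_left_mono) (auto simp: N_def)
    finally show ?case by (simp add: N_def)
  qed
  have Gc: "(G \<longlongrightarrow> G t) (at t)"
  proof (rule Lim_null[THEN iffD2], rule Lim_null_comparison)
    show "((\<lambda>s. 2 * N * norm (F s - F t) * N) \<longlongrightarrow> 0) (at t)"
      by (rule tendsto_eq_intros Fc refl | simp)+
    show "\<forall>\<^sub>F s in at t. norm (G s - G t) \<le> 2 * N * norm (F s - F t) * N"
      using evI bound
    proof eventually_elim
      case (elim s)
      have "norm (G s - G t) = norm (G s o\<^sub>L (F s - F t) o\<^sub>L G t)"
        using id[OF elim(1)] by simp
      also have "\<dots> \<le> norm (G s o\<^sub>L (F s - F t)) * norm (G t)" by (rule norm_blinfun_compose)
      also have "\<dots> \<le> norm (G s) * norm (F s - F t) * norm (G t)"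
        by (intro mult_right_mono norm_blinfun_compose) simp
      also have "\<dots> \<le> 2 * N * norm (F s - F t) * N"
        using elim(2) by (auto intro!: mult_right_mono simp: N_def)
      finally show ?case .
    qed
  qed
  have quot: "((\<lambda>s. (F s - F t) /\<^sub>R (s - t)) \<longlongrightarrow> F') (at t)"
    using F by (simp add: has_vector_derivative_iff_quotient)
  have "((\<lambda>s. - (G s o\<^sub>L ((F s - F t) /\<^sub>R (s - t)) o\<^sub>L G t)) \<longlongrightarrow> - (G t o\<^sub>L F' o\<^sub>L G t)) (at t)"
    by (intro tendsto_intros Gc quot)
  moreover have "\<forall>\<^sub>F s in at t. - (G s o\<^sub>L ((F s - F t) /\<^sub>R (s - t)) o\<^sub>L G t) = (G s - G t) /\<^sub>R (s - t)"
    using evI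
  proof eventually_elim
    case (elim s)
    show ?case
      by (subst id[OF elim]) (intro blinfun_eqI, simp add: blinfun.scaleR_left blinfun.scaleR_right blinfun.minus_left)
  qed
  ultimately have "((\<lambda>s. (G s - G t) /\<^sub>R (s - t)) \<longlongrightarrow> - (G t o\<^sub>L F' o\<^sub>L G t)) (at t)"
    by (rule Lim_transform_eventually)
  then show ?thesis by (simp add: has_vector_derivative_iff_quotient)
qed

lemma smooth_family_inverse:
  fixes F :: "real \<Rightarrow> 'a::real_normed_vector \<Rightarrow>\<^sub>L 'b::real_normed_vector"
  assumes "open I" "smooth_family I F"
    and inv: "\<And>s. s \<in> I \<Longrightarrow> G s o\<^sub>L F s = id_blinfun" "\<And>s. s \<in> I \<Longrightarrow> F s o\<^sub>L G s = id_blinfun"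
  shows "smooth_family I G"
  unfolding smooth_family_iff_C_diff[OF assms(1)]
proof
  fix n
  let ?F' = "\<lambda>t. vector_derivative F (at t)"
  let ?G' = "\<lambda>t. - (G t o\<^sub>L ?F' t o\<^sub>L G t)"
  have G: "(G has_vector_derivative ?G' t) (at t)" if "t \<in> I" for t
    using inverse_has_vector_derivative[OF inv assms(1) that
        smooth_family_has_vector_derivative[OF assms(1,2) that]] .
  show "C_diff n I G"
  proof (induction n)
    case (Suc n)
    have "C_diff n I ?F'"
      using smooth_family_vector_derivative[OF assms(1,2)] smooth_family_iff_C_diff[OF assms(1)] by blast
    then have "C_diff n I ?G'"
      by (intro bounded_linear.C_diff_compose[OF bounded_linear_minus[OF bounded_linear_ident]] Suc
          bounded_bilinear.C_diff_prod[OF bounded_bilinear_blinfun_compose])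
    then show ?case using G by (auto intro!: exI[of _ ?G'])
  qed simp
qed

section \<open>Linear differential equations\<close>

text \<open>
  The mean value inequality on an interval around \<open>0\<close>; it gives both the contraction estimate for
  the existence of solutions and their uniqueness.
\<close>

lemma norm_le_of_vector_derivative_le:
  fixes w :: "real \<Rightarrow> 'a::real_normed_vector"
  assumes "\<And>s. \<bar>s\<bar> \<le> d \<Longrightarrow> (w has_vector_derivative w' s) (at s within {-d..d})"
    and "\<And>s. \<bar>s\<bar> \<le> d \<Longrightarrow> norm (w' s) \<le> B"
    and "w 0 = 0" "\<bar>t\<bar> \<le> d"
  shows "norm (w t) \<le> d * B"
proof -
  have d: "0 \<le> d" using assms(4) by linarith
  have B: "0 \<le> B" using assms(2)[of 0] d order_trans[OF norm_ge_zero] by simp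
  have "norm (w t - w 0) \<le> B * norm (t - 0)"
  proof (rule differentiable_bound[where S = "{-d..d}" and f' = "\<lambda>s h. h *\<^sub>R w' s"])
    fix s assume "s \<in> {-d..d}"
    then have s: "\<bar>s\<bar> \<le> d" by auto
    show "(w has_derivative (\<lambda>h. h *\<^sub>R w' s)) (at s within {-d..d})"
      using assms(1)[OF s] by (simp add: has_vector_derivative_def)
    show "onorm (\<lambda>h. h *\<^sub>R w' s) \<le> B"
      using assms(2)[OF s] by (intro onorm_le) (simp add: mult.commute[of B] mult_left_mono)
  qed (use assms(4) d in auto)
  also have "\<dots> \<le> B * d" using assms(4) B by (intro mult_left_mono) auto
  finally show ?thesis using assms(3) by (simp add: mult.commute)
qed

text \<open>
  Picard iteration.  On a short interval \<open>[-d, d]\<close>, sending \<open>y\<close> to the antiderivative of \<open>p (A t) (y t)\<close>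
  with value \<open>y0\<close> at \<open>0\<close> is a contraction for the supremum norm.  To work in the complete space of
  bounded continuous functions on the whole line, antiderivatives are extended by constants beyond
  the ends of the interval.
\<close>

lemma linear_ODE_solution_exists:
  fixes p :: "'a::real_normed_vector \<Rightarrow> 'b::banach \<Rightarrow> 'b"
  assumes p: "bounded_bilinear p" and I: "open I" "0 \<in> I" and A: "continuous_on I A"
  obtains d y where "d > 0" "y 0 = y0"
    "\<And>t. \<bar>t\<bar> < d \<Longrightarrow> (y has_vector_derivative p (A t) (y t)) (at t)"
proof -
  interpret bounded_bilinear p by fact
  obtain C where C: "C > 0" "\<And>a b. norm (p a b) \<le> norm a * norm b * C"
    using pos_bounded by blast
  obtain e where e: "e > 0" "cball 0 e \<subseteq> I"
    using I open_contains_cball by blast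
  have "compact (A ` cball 0 e)"
    using A e by (intro compact_continuous_image) (auto intro: continuous_on_subset)
  then obtain M where M: "M > 0" "\<And>t. \<bar>t\<bar> \<le> e \<Longrightarrow> norm (A t) \<le> M"
    by (auto simp: bounded_pos dest!: compact_imp_bounded)
  \<comment> \<open>the contraction constant is \<open>d * (M * C)\<close>\<close>
  define d where "d = min e (1 / (2 * M * C))"
  have d: "d > 0" "d \<le> e" "d * (M * C) \<le> 1 / 2"
    using e M C by (auto simp: d_def min_def field_simps)
  let ?S = "{-d..d}"
  have "?S \<subseteq> cball 0 e" using d by auto
  then have "continuous_on ?S A" using A e(2) continuous_on_subset by blast
  then have cont: "continuous_on ?S (\<lambda>t. p (A t) (apply_bcontfun y t))" for y
    by (intro continuous_on continuous_on_apply_bcontfun)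
  have "\<exists>z :: real \<Rightarrow>\<^sub>C 'b. z 0 = y0 \<and>
      (\<forall>t\<in>?S. (z has_vector_derivative p (A t) (apply_bcontfun y t)) (at t within ?S)) \<and>
      (\<forall>t. z t = z (clamp (-d) d t))" for y
  proof -
    obtain g where g: "\<And>t. t \<in> ?S \<Longrightarrow>
        (g has_vector_derivative p (A t) (apply_bcontfun y t)) (at t within ?S)"
      using antiderivative_continuous[OF cont] by blast
    define h where "h t = y0 + (g t - g 0)" for t
    have h: "(h has_vector_derivative p (A t) (apply_bcontfun y t)) (at t within ?S)" if "t \<in> ?S" for t
      unfolding h_def by (auto intro!: derivative_eq_intros g that)
    have "continuous_on (cbox (-d) d) h"
      unfolding continuous_on_eq_continuous_within box_real
      using has_vector_derivative_continuous[OF h] by blast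
    then obtain z :: "real \<Rightarrow>\<^sub>C 'b" where z: "\<And>t. t \<in> cbox (-d) d \<Longrightarrow> z t = h t"
      "\<And>t. z t = h (clamp (-d) d t)"
      using continuous_on_cbox_bcontfunE[of "-d" d h] by metis
    have "(z has_vector_derivative p (A t) (apply_bcontfun y t)) (at t within ?S)" if "t \<in> ?S" for t
      using has_vector_derivative_transform[OF that _ h[OF that]] z(1) by auto
    moreover have "z 0 = y0" using z(1)[of 0] d by (simp add: h_def)
    moreover have "z t = z (clamp (-d) d t)" for t
      using z(1)[OF clamp_in_interval, of t] z(2)[of t] d by simp
    ultimately show ?thesis by blast
  qed
  then obtain T :: "(real \<Rightarrow>\<^sub>C 'b) \<Rightarrow> (real \<Rightarrow>\<^sub>C 'b)" where T: "\<And>y. T y 0 = y0"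
    "\<And>y t. t \<in> ?S \<Longrightarrow> (T y has_vector_derivative p (A t) (y t)) (at t within ?S)"
    "\<And>y t. T y t = T y (clamp (-d) d t)"
    by metis
  have "\<exists>!y. T y = y"
  proof (rule banach_fix_type)
    show "0 \<le> (1/2::real)" "(1/2::real) < 1" by auto
    have "dist (T y t) (T z t) \<le> 1/2 * dist y z" if t: "\<bar>t\<bar> \<le> d" for y z t
    proof -
      have "norm (T y t - T z t) \<le> d * (M * dist y z * C)"
      proof (rule norm_le_of_vector_derivative_le[where w' = "\<lambda>s. p (A s) (y s) - p (A s) (z s)"])
        fix s :: real assume s: "\<bar>s\<bar> \<le> d"
        show "((\<lambda>t. T y t - T z t) has_vector_derivative p (A s) (y s) - p (A s) (z s))
            (at s within ?S)"
          using s by (intro has_vector_derivative_diff T) auto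
        have "norm (p (A s) (y s) - p (A s) (z s)) \<le> norm (A s) * norm (y s - z s) * C"
          using C(2)[of "A s" "y s - z s"] by (simp add: diff_right)
        also have "\<dots> \<le> M * dist y z * C"
          using C(1) M d s dist_bounded[of y s z]
          by (intro mult_right_mono mult_mono) (auto simp: dist_norm)
        finally show "norm (p (A s) (y s) - p (A s) (z s)) \<le> M * dist y z * C" .
      qed (use t in \<open>simp_all add: T(1)\<close>)
      also have "\<dots> = (d * (M * C)) * dist y z" by simp
      also have "\<dots> \<le> 1/2 * dist y z" using d by (intro mult_right_mono) auto
      finally show ?thesis by (simp add: dist_norm)
    qed
    moreover have "\<bar>clamp (-d) d t\<bar> \<le> d" for t
      using clamp_in_interval[of "-d" d t] d by (auto simp: abs_le_iff)
    ultimately show "\<forall>y z. dist (T y) (T z) \<le> 1/2 * dist y z"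
      by (metis T(3) dist_bound)
  qed
  then obtain y where y: "T y = y" by blast
  have "(y has_vector_derivative p (A t) (y t)) (at t)" if "\<bar>t\<bar> < d" for t
    using T(2)[of t y] that at_within_interior[of t ?S] by (auto simp: y abs_less_iff)
  then show thesis
    using that[of d y] d T(1)[of y] y by simp
qed

text \<open>
  At a point \<open>s\<close> where the norm of \<open>w\<close> is maximal on \<open>[-|t|, |t|]\<close>, the mean value inequality gives
  \<open>norm (w s) \<le> |t| * K * norm (w s)\<close> with \<open>|t| * K < 1\<close>.
\<close>

lemma linear_ODE_solution_unique:
  fixes w :: "real \<Rightarrow> 'a::real_normed_vector"
  assumes w: "\<And>t. \<bar>t\<bar> < d \<Longrightarrow> (w has_vector_derivative w' t) (at t)"
    and K: "\<And>t. \<bar>t\<bar> < d \<Longrightarrow> norm (w' t) \<le> K * norm (w t)" "0 \<le> K" "d * K \<le> 1"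
    and "w 0 = 0" "\<bar>t\<bar> < d"
  shows "w t = 0"
proof -
  define e where "e = \<bar>t\<bar>"
  have e: "0 \<le> e" "e < d" using assms(6) by (auto simp: e_def)
  have "isCont w r" if "r \<in> {-e..e}" for r
    using has_vector_derivative_continuous[OF w[of r]] that e by auto
  then have "continuous_on {-e..e} w"
    by (simp add: continuous_at_imp_continuous_on)
  then have "continuous_on {-e..e} (\<lambda>s. norm (w s))"
    by (rule continuous_on_norm)
  then obtain s where "s \<in> {-e..e}" and sup: "\<forall>r\<in>{-e..e}. norm (w r) \<le> norm (w s)"
    using continuous_attains_sup[of "{-e..e}" "\<lambda>s. norm (w s)"] e by auto
  then have s: "\<bar>s\<bar> \<le> e" by auto
  have max: "norm (w r) \<le> norm (w s)" if "\<bar>r\<bar> \<le> e" for r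
    by (rule bspec[OF sup]) (use that in auto)
  have le: "norm (w s) \<le> e * (K * norm (w s))"
  proof (rule norm_le_of_vector_derivative_le[where w' = w'])
    fix r assume r: "\<bar>r\<bar> \<le> e"
    show "(w has_vector_derivative w' r) (at r within {-e..e})"
      by (rule has_vector_derivative_at_within[OF w]) (use r e in linarith)
    show "norm (w' r) \<le> K * norm (w s)"
      by (rule order_trans[OF K(1) mult_left_mono[OF max[OF r] K(2)]]) (use r e in linarith)
  qed (use s assms(5) in simp_all)
  have "w s = 0"
  proof (cases "K = 0")
    case False
    have "e * K < d * K" using e K False by (intro mult_strict_right_mono) auto
    then have "e * K < 1" using K by linarith
    show ?thesis
    proof (rule ccontr)
      assume "w s \<noteq> 0"
      then have "e * K * norm (w s) < 1 * norm (w s)"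
        using \<open>e * K < 1\<close> by (intro mult_strict_right_mono) auto
      with le show False by (simp add: mult.assoc)
    qed
  qed (use le in auto)
  then show ?thesis using max[of t] by (simp add: e_def)
qed

lemma continuous_bounded_near_0:
  fixes X :: "real \<Rightarrow> 'a::real_normed_vector"
  assumes "open I" "0 \<in> I" "continuous_on I X"
  obtains K e where "K > 0" "e > 0" "\<And>t. \<bar>t\<bar> < e \<Longrightarrow> norm (X t) \<le> K"
proof -
  have "isCont X 0" using assms continuous_on_eq_continuous_at by blast
  then obtain e where e: "e > 0" "\<And>t. dist t 0 < e \<Longrightarrow> dist (X t) (X 0) < 1"
    unfolding continuous_at_eps_delta by (metis zero_less_one)
  have "norm (X t) \<le> norm (X 0) + 1" if "\<bar>t\<bar> < e" for t
    using e(2)[of t] that norm_triangle_ineq2[of "X t" "X 0"] by (simp add: dist_norm)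
  then show thesis using e(1) that[of "norm (X 0) + 1" e] by (simp add: add_nonneg_pos)
qed

section \<open>Infinitesimal deformations\<close>

text \<open>
  For \<open>c = \<pi> \<circ> f\<close> the differential is \<open>(\<delta>c)(x,y) = x \<cdot> c(y) - y \<cdot> c(x) - c([x,y])\<close>, and all three terms are
  cosets of explicit representatives.
\<close>

lemma cochain1_quotient_cocycle_iff:
  fixes \<gamma> :: "'g::real_normed_vector bracket" and \<beta> :: "'h::real_normed_vector bracket"
  assumes "lie_hom \<beta> \<gamma> j"
  shows "cochain1 (quot_proj (range (blinfun_apply j)) \<circ> blinfun_apply f)
      \<in> CE_cocycles 1 \<beta> (quotient_module \<gamma> j) \<longleftrightarrow>
    (\<forall>x y. \<gamma> (j x) (f y) - \<gamma> (j y) (f x) - f (\<beta> x y) \<in> range (blinfun_apply j))"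
proof -
  let ?\<pi> = "quot_proj (range (blinfun_apply j))" and ?V = "quotient_module \<gamma> j"
  let ?c = "cochain1 (?\<pi> \<circ> blinfun_apply f)"
  note [simp] = quotient_module_simps quotient_module_act[OF assms]
  have "?c \<in> CE_cochains 1 ?V"
    by (auto simp: CE_cochains_def cochain1_def length_Suc_conv blinfun.add_right blinfun.scaleR_right)
  moreover have "CE_differential \<beta> ?V ?c [x, y] =
      ?\<pi> (\<gamma> (j x) (f y) - \<gamma> (j y) (f x) - f (\<beta> x y))" for x y
    by (simp add: CE_differential_def cochain1_def omit_def nths_Cons algebra_simps)
  moreover have "(\<forall>xs :: 'h list. length xs = Suc 1 \<longrightarrow> P xs) \<longleftrightarrow> (\<forall>x y. P [x, y])" for P
    by (auto simp: length_Suc_conv)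
  ultimately show ?thesis
    unfolding CE_cocycles_def mem_Collect_eq
    by (simp add: quot_proj_eq_iff[OF subspace_range_blinfun])
qed

lemma quot_proj_comp_eq_iff:
  "quot_proj (range (blinfun_apply j)) \<circ> f = quot_proj (range (blinfun_apply j)) \<circ> g \<longleftrightarrow>
    (\<forall>x. f x - g x \<in> range (blinfun_apply j))"
  by (simp add: fun_eq_iff quot_proj_eq_iff[OF subspace_range_blinfun])

lemma bracket_antisym: "lie_bracket \<beta> \<Longrightarrow> \<beta> x y = - \<beta> y x"
proof -
  assume "lie_bracket \<beta>"
  then have "\<beta> (x + y) (x + y) = 0" "\<beta> x x = 0" "\<beta> y y = 0"
    by (auto simp: lie_bracket_def)
  then show ?thesis
    by (simp add: blinfun.add_left blinfun.add_right eq_neg_iff_add_eq_0 add.commute)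
qed

text \<open>
  The morphism identity \<open>F\<^sub>s(\<beta>\<^sub>s(x,y)) = \<gamma>(F\<^sub>s x, F\<^sub>s y)\<close>, differentiated at \<open>t\<close>.  With \<open>\<beta>\<close> the varying
  brackets on \<open>\<hh>\<close> it yields the cocycle condition; with constant \<open>\<beta> = \<gamma>\<close> it shows that the logarithmic
  derivative of a curve of automorphisms is a derivation.
\<close>

lemma derivative_of_lie_homs:
  fixes \<gamma> :: "'g::real_normed_vector bracket" and \<beta> :: "real \<Rightarrow> 'h::real_normed_vector bracket"
    and F :: "real \<Rightarrow> 'h \<Rightarrow>\<^sub>L 'g"
  assumes "open I" "t \<in> I" "\<And>s. s \<in> I \<Longrightarrow> lie_hom (\<beta> s) \<gamma> (F s)"
    and \<beta>: "(\<beta> has_vector_derivative \<beta>') (at t)" and F: "(F has_vector_derivative F') (at t)"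
  shows "F t (\<beta>' x y) + F' (\<beta> t x y) = \<gamma> (F t x) (F' y) + \<gamma> (F' x) (F t y)"
proof (rule has_vector_derivative_unique_on_open[OF _ _ assms(1,2)])
  note app = has_vector_derivative_blinfun_apply_const
  show "((\<lambda>s. F s (\<beta> s x y)) has_vector_derivative F t (\<beta>' x y) + F' (\<beta> t x y)) (at t)"
    by (intro blinfun.has_vector_derivative F app \<beta>)
  show "((\<lambda>s. \<gamma> (F s x) (F s y)) has_vector_derivative \<gamma> (F t x) (F' y) + \<gamma> (F' x) (F t y)) (at t)"
    by (intro blinfun.has_vector_derivative
        bounded_linear.has_vector_derivative[OF blinfun.bounded_linear_right] app F)
  show "F s (\<beta> s x y) = \<gamma> (F s x) (F s y)" if "s \<in> I" for s
    using assms(3)[OF that] by (simp add: lie_hom_def)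
qed

text \<open>
  The defect \<open>w\<^sub>t = \<Psi>\<^sub>t(\<gamma>(x,y)) - \<gamma>(\<Psi>\<^sub>t x, \<Psi>\<^sub>t y)\<close> satisfies \<open>w' = X\<^sub>t w\<close>, by the derivation property of \<open>X\<^sub>t\<close>,
  and vanishes at \<open>t = 0\<close>.  The bound \<open>d * K \<le> 1\<close> makes the interval short enough for uniqueness and
  does not depend on \<open>x\<close> and \<open>y\<close>.
\<close>

lemma derivation_flow_lie_hom:
  fixes \<gamma> :: "'g::real_normed_vector bracket" and X \<Psi> :: "real \<Rightarrow> 'g \<Rightarrow>\<^sub>L 'g"
  assumes \<Psi>: "\<And>t. \<bar>t\<bar> < d \<Longrightarrow> (\<Psi> has_vector_derivative X t o\<^sub>L \<Psi> t) (at t)" "\<Psi> 0 = id_blinfun"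
    and X: "\<And>t x y. \<bar>t\<bar> < d \<Longrightarrow> X t (\<gamma> x y) = \<gamma> (X t x) y + \<gamma> x (X t y)"
    and K: "\<And>t. \<bar>t\<bar> < d \<Longrightarrow> norm (X t) \<le> K" "0 \<le> K" "d * K \<le> 1"
    and t: "\<bar>t\<bar> < d"
  shows "lie_hom \<gamma> \<gamma> (\<Psi> t)"
  unfolding lie_hom_def
proof (intro allI)
  fix x y
  note app = has_vector_derivative_blinfun_apply_const
  let ?w = "\<lambda>t. \<Psi> t (\<gamma> x y) - \<gamma> (\<Psi> t x) (\<Psi> t y)"
  have "?w t = 0"
  proof (rule linear_ODE_solution_unique[where w' = "\<lambda>t. X t (?w t)"])
    fix s assume s: "\<bar>s\<bar> < d"
    have "(?w has_vector_derivative (X s o\<^sub>L \<Psi> s) (\<gamma> x y)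
        - (\<gamma> (\<Psi> s x) ((X s o\<^sub>L \<Psi> s) y) + \<gamma> ((X s o\<^sub>L \<Psi> s) x) (\<Psi> s y))) (at s)"
      by (intro has_vector_derivative_diff blinfun.has_vector_derivative
        bounded_linear.has_vector_derivative[OF blinfun.bounded_linear_right] app \<Psi> s)
    then show "(?w has_vector_derivative X s (?w s)) (at s)"
      by (simp add: blinfun.diff_right X[OF s] add.commute)
    show "norm (X s (?w s)) \<le> K * norm (?w s)"
      using norm_blinfun[of "X s" "?w s"] mult_right_mono[OF K(1)[OF s] norm_ge_zero[of "?w s"]] by linarith
  qed (use K t \<Psi>(2) in auto)
  then show "\<Psi> t (\<gamma> x y) = \<gamma> (\<Psi> t x) (\<Psi> t y)" by simp
qed

section \<open>Trivial deformations and derivations\<close>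

text \<open>
  The witness is the logarithmic derivative \<open>X = \<Psi>' \<circ> \<Psi>\<^sup>-\<^sup>1\<close> of the trivializing curve of automorphisms.
\<close>

lemma Aut_trivial_imp_derivations:
  fixes \<gamma> :: "'g::finite_dim_space bracket"
    and \<mu> :: "'h::real_normed_vector bracket"
    and \<iota>t :: "real \<Rightarrow> 'h \<Rightarrow>\<^sub>L 'g"
  assumes I: "open I"
    and \<iota>t: "smooth_family I \<iota>t"
    and triv: "Aut_trivial I \<gamma> \<mu> \<iota> \<mu>t \<iota>t"
  shows "\<exists>X :: real \<Rightarrow> 'g \<Rightarrow>\<^sub>L 'g. smooth_family I X \<and>
    (\<forall>t\<in>I. \<forall>x y. blinfun_apply (X t) (\<gamma> x y) =
      \<gamma> (blinfun_apply (X t) x) y + \<gamma> x (blinfun_apply (X t) y)) \<and>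
    (\<forall>t\<in>I. \<forall>x. vector_derivative \<iota>t (at t) x - blinfun_apply (X t) (\<iota>t t x) \<in> range (blinfun_apply (\<iota>t t)))"
proof -
  obtain \<psi> :: "real \<Rightarrow> 'h \<Rightarrow>\<^sub>L 'h" and \<Psi> :: "real \<Rightarrow> 'g \<Rightarrow>\<^sub>L 'g"
    where \<psi>: "smooth_family I \<psi>" "\<And>t. t \<in> I \<Longrightarrow> \<psi> t \<in> GL"
      and \<Psi>: "smooth_family I \<Psi>" "\<And>t. t \<in> I \<Longrightarrow> \<Psi> t \<in> lie_Aut \<gamma>"
      and eq: "\<And>t. t \<in> I \<Longrightarrow> \<iota>t t o\<^sub>L \<psi> t = \<Psi> t o\<^sub>L \<iota>"
    using triv unfolding Aut_trivial_def by blast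
  have hom: "lie_hom \<gamma> \<gamma> (\<Psi> t)" and "\<Psi> t \<in> GL" if "t \<in> I" for t
    using \<Psi>(2)[OF that] by (auto simp: lie_Aut_def lie_iso_def GL_def)
  then have "\<exists>g. t \<in> I \<longrightarrow> g o\<^sub>L \<Psi> t = id_blinfun \<and> \<Psi> t o\<^sub>L g = id_blinfun" for t
    using GL_inverse by metis
  then obtain G where G: "\<And>t. t \<in> I \<Longrightarrow> G t o\<^sub>L \<Psi> t = id_blinfun"
    "\<And>t. t \<in> I \<Longrightarrow> \<Psi> t o\<^sub>L G t = id_blinfun" by metis
  have inv: "G t (\<Psi> t x) = x" "\<Psi> t (G t x) = x" if "t \<in> I" for t x
    using G[OF that] by (metis blinfun_apply_blinfun_compose id_blinfun.rep_eq)+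
  note deriv = smooth_family_has_vector_derivative[OF I]
  let ?\<Psi>' = "\<lambda>t. vector_derivative \<Psi> (at t)" and ?\<iota>' = "\<lambda>t. vector_derivative \<iota>t (at t)"
    and ?\<psi>' = "\<lambda>t. vector_derivative \<psi> (at t)"
  let ?X = "\<lambda>t. ?\<Psi>' t o\<^sub>L G t"
  have "smooth_family I ?X"
    by (intro smooth_family_blinfun_compose smooth_family_vector_derivative
        smooth_family_inverse[OF I \<Psi>(1)] I \<Psi>(1) G)
  moreover have "?X t (\<gamma> x y) = \<gamma> (?X t x) y + \<gamma> x (?X t y)" if t: "t \<in> I" for t x y
  proof -
    have "G t (\<gamma> x y) = \<gamma> (G t x) (G t y)"
      using hom[OF t] inv[OF t] unfolding lie_hom_def by metis
    then show ?thesis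
      using derivative_of_lie_homs[OF I t hom has_vector_derivative_const deriv[OF \<Psi>(1) t],
          of "G t x" "G t y"]
      by (simp add: inv[OF t] add.commute)
  qed
  moreover have "?\<iota>' t x - ?X t (\<iota>t t x) \<in> range (blinfun_apply (\<iota>t t))" if t: "t \<in> I" for t x
  proof -
    \<comment> \<open>\<open>x\<close> is moved along the curve \<open>s \<mapsto> \<psi>\<^sub>s u\<close>, on which \<open>\<iota>\<^sub>s\<close> takes the values \<open>\<Psi>\<^sub>s(\<iota> u)\<close>\<close>
    obtain u where x: "x = \<psi> t u" using \<psi>(2)[OF t] unfolding GL_def bij_def by blast
    have "\<iota>t t (?\<psi>' t u) + ?\<iota>' t (\<psi> t u) = ?\<Psi>' t (\<iota> u)"
    proof (rule has_vector_derivative_unique_on_open[OF _ _ I t])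
      show "((\<lambda>s. \<iota>t s (\<psi> s u)) has_vector_derivative \<iota>t t (?\<psi>' t u) + ?\<iota>' t (\<psi> t u)) (at t)"
        by (intro blinfun.has_vector_derivative has_vector_derivative_blinfun_apply_const
            deriv \<iota>t \<psi>(1) t)
      show "((\<lambda>s. \<Psi> s (\<iota> u)) has_vector_derivative ?\<Psi>' t (\<iota> u)) (at t)"
        by (intro has_vector_derivative_blinfun_apply_const deriv \<Psi>(1) t)
      show "\<iota>t s (\<psi> s u) = \<Psi> s (\<iota> u)" if "s \<in> I" for s
        using eq[OF that] by (metis blinfun_apply_blinfun_compose)
    qed
    moreover have "\<iota>t t x = \<Psi> t (\<iota> u)"
      unfolding x using eq[OF t] by (metis blinfun_apply_blinfun_compose)
    ultimately have "?\<iota>' t x - ?X t (\<iota>t t x) = \<iota>t t (- ?\<psi>' t u)"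
      by (simp add: x inv[OF t] blinfun.minus_right algebra_simps)
    then show ?thesis by simp
  qed
  ultimately show ?thesis by (intro exI[of _ ?X]) blast
qed

text \<open>
  The trivialization consists of the flows of two time-dependent linear vector fields: \<open>\<Psi>\<close> is the
  flow of \<open>X\<close> on \<open>\<gg>\<close>, and \<open>\<psi>\<close> the flow on \<open>\<hh>\<close> of the field \<open>\<theta>\<close> with \<open>\<iota>\<^sub>t \<circ> \<theta>\<^sub>t = X\<^sub>t \<circ> \<iota>\<^sub>t - \<iota>'\<^sub>t\<close>, which corrects
  the part of the motion of \<open>\<iota>\<^sub>t\<close> inside its own image.
\<close>

lemma derivations_imp_Aut_trivial:
  fixes \<gamma> :: "'g::finite_dim_space bracket"
    and \<mu> :: "'h::finite_dim_space bracket"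
    and X :: "real \<Rightarrow> 'g \<Rightarrow>\<^sub>L 'g"
    and \<iota>t :: "real \<Rightarrow> 'h \<Rightarrow>\<^sub>L 'g"
  assumes I: "open I" "0 \<in> I"
    and \<iota>: "lie_hom \<mu> \<gamma> \<iota>" "inj (blinfun_apply \<iota>)"
    and def: "lie_subalgebra_deformation I \<gamma> \<mu> \<iota> \<mu>t \<iota>t"
    and X: "smooth_family I X"
    and der: "\<And>t x y. t \<in> I \<Longrightarrow> X t (\<gamma> x y) = \<gamma> (X t x) y + \<gamma> x (X t y)"
    and tangent: "\<And>t x. t \<in> I \<Longrightarrow>
      vector_derivative \<iota>t (at t) x - X t (\<iota>t t x) \<in> range (blinfun_apply (\<iota>t t))"
  shows "\<exists>I'. I' \<subseteq> I \<and> open_interval I' \<and> 0 \<in> I' \<and> Aut_trivial I' \<gamma> \<mu> \<iota> \<mu>t \<iota>t"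
proof -
  have \<iota>t: "smooth_family I \<iota>t" "\<iota>t 0 = \<iota>" "\<And>t. t \<in> I \<Longrightarrow> lie_hom (\<mu>t t) \<gamma> (\<iota>t t)"
    "\<And>t. t \<in> I \<Longrightarrow> inj (blinfun_apply (\<iota>t t))"
    using def by (auto simp: lie_subalgebra_deformation_def)
  let ?\<iota>' = "\<lambda>t. vector_derivative \<iota>t (at t)"
  obtain p where p: "p o\<^sub>L \<iota> = id_blinfun" using left_inverse_blinfun[OF \<iota>(2)] .
  \<comment> \<open>\<open>c 0\<close> is the identity, so \<open>c t\<close> is invertible near \<open>0\<close> and \<open>(c t)\<^sup>-\<^sup>1 \<circ> p\<close> is a left inverse of \<open>\<iota>\<^sub>t\<close>\<close>
  define c where "c t = p o\<^sub>L \<iota>t t" for t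
  have c: "smooth_family I c"
    unfolding c_def by (intro smooth_family_blinfun_compose smooth_family_const \<iota>t I)
  obtain e1 where e1: "e1 > 0" "\<And>t. \<bar>t\<bar> < e1 \<Longrightarrow> c t \<in> GL"
    using GL_near_0[OF I smooth_family_continuous_on[OF I(1) c]] p by (auto simp: c_def \<iota>t(2))
  obtain e0 where e0: "e0 > 0" "ball 0 e0 \<subseteq> I" using I open_contains_ball by blast
  define J where "J = {- min e0 e1 <..< min e0 e1}"
  have J: "open J" "0 \<in> J" "J \<subseteq> I" "\<And>t. t \<in> J \<Longrightarrow> \<bar>t\<bar> < e1"
    using e0 e1(1) by (auto simp: J_def subset_iff)
  have "\<exists>g. t \<in> J \<longrightarrow> g o\<^sub>L c t = id_blinfun \<and> c t o\<^sub>L g = id_blinfun" for t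
    using GL_inverse e1(2) J(4) by metis
  then obtain N where N: "\<And>t. t \<in> J \<Longrightarrow> N t o\<^sub>L c t = id_blinfun"
    "\<And>t. t \<in> J \<Longrightarrow> c t o\<^sub>L N t = id_blinfun" by metis
  note smJ = smooth_family_subset[OF _ J(3)]
  have smN: "smooth_family J N"
    by (rule smooth_family_inverse[OF J(1) smJ[OF c] N])
  define \<theta> where "\<theta> t = N t o\<^sub>L (p o\<^sub>L ((X t o\<^sub>L \<iota>t t) - ?\<iota>' t))" for t
  have sm\<theta>: "smooth_family J \<theta>"
    unfolding \<theta>_def
    by (intro smooth_family_blinfun_compose smooth_family_const smooth_family_diff
        smooth_family_vector_derivative smN smJ[OF X] smJ[OF \<iota>t(1)] J(1))
  have \<theta>: "\<iota>t t (\<theta> t x) = X t (\<iota>t t x) - ?\<iota>' t x" if t: "t \<in> J" for t x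
  proof -
    obtain v where v: "?\<iota>' t x - X t (\<iota>t t x) = \<iota>t t v"
      using tangent[of t x] t J(3) by blast
    then have v': "X t (\<iota>t t x) - ?\<iota>' t x = \<iota>t t (- v)"
      by (simp add: blinfun.minus_right flip: v)
    have "\<theta> t x = N t (c t (- v))"
      unfolding \<theta>_def c_def by (simp add: blinfun.diff_left v')
    also have "\<dots> = - v"
      using N(1)[OF t] by (metis blinfun_apply_blinfun_compose id_blinfun.rep_eq)
    finally show ?thesis using v' by simp
  qed
  obtain d1 \<Psi> where d1: "d1 > 0" "\<Psi> 0 = id_blinfun"
    "\<And>t. \<bar>t\<bar> < d1 \<Longrightarrow> (\<Psi> has_vector_derivative X t o\<^sub>L \<Psi> t) (at t)"
    using linear_ODE_solution_exists[OF bounded_bilinear_blinfun_compose I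
        smooth_family_continuous_on[OF I(1) X]] by blast
  obtain d2 \<psi> where d2: "d2 > 0" "\<psi> 0 = id_blinfun"
    "\<And>t. \<bar>t\<bar> < d2 \<Longrightarrow> (\<psi> has_vector_derivative \<theta> t o\<^sub>L \<psi> t) (at t)"
    using linear_ODE_solution_exists[OF bounded_bilinear_blinfun_compose J(1,2)
        smooth_family_continuous_on[OF J(1) sm\<theta>]] by blast
  \<comment> \<open>both flows are defined and smooth on \<open>D\<close>\<close>
  define D where "D = J \<inter> {- min d1 d2 <..< min d1 d2}"
  have D: "open D" "0 \<in> D" "D \<subseteq> J" "\<And>t. t \<in> D \<Longrightarrow> \<bar>t\<bar> < d1" "\<And>t. t \<in> D \<Longrightarrow> \<bar>t\<bar> < d2"
    using J d1(1) d2(1) by (auto simp: D_def)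
  have sm\<Psi>: "smooth_family D \<Psi>"
    using smooth_family_linear_ODE[OF D(1) bounded_bilinear_blinfun_compose
        smooth_family_subset[OF X] d1(3)] D J(3) by blast
  have sm\<psi>: "smooth_family D \<psi>"
    using smooth_family_linear_ODE[OF D(1) bounded_bilinear_blinfun_compose
        smooth_family_subset[OF sm\<theta> D(3)] d2(3)] D by blast
  obtain e2 where e2: "e2 > 0" "\<And>t. \<bar>t\<bar> < e2 \<Longrightarrow> \<Psi> t \<in> GL"
    using GL_near_0[OF D(1,2) smooth_family_continuous_on[OF D(1) sm\<Psi>] d1(2)] by blast
  obtain e3 where e3: "e3 > 0" "\<And>t. \<bar>t\<bar> < e3 \<Longrightarrow> \<psi> t \<in> GL"
    using GL_near_0[OF D(1,2) smooth_family_continuous_on[OF D(1) sm\<psi>] d2(2)] by blast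
  obtain K e4 where K: "K > 0" "e4 > 0" "\<And>t. \<bar>t\<bar> < e4 \<Longrightarrow> norm (X t) \<le> K"
    using continuous_bounded_near_0[OF I smooth_family_continuous_on[OF I(1) X]] by blast
  obtain e5 where e5: "e5 > 0" "ball 0 e5 \<subseteq> D" using D(1,2) open_contains_ball by blast
  \<comment> \<open>the bound \<open>1 / K\<close> is what uniqueness for equations \<open>w' = X\<^sub>t w\<close> requires\<close>
  define d where "d = min (min (min e2 e3) (min e4 e5)) (1 / K)"
  have "d \<le> 1 / K" by (simp add: d_def)
  then have "d * K \<le> 1" using K(1) by (simp add: field_simps)
  then have d: "0 < d" "d \<le> e2" "d \<le> e3" "d \<le> e4" "d \<le> e5" "d * K \<le> 1"
    using e2(1) e3(1) e5(1) K(1,2) by (auto simp: d_def)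
  have tD: "t \<in> D" if "\<bar>t\<bar> < d" for t
    using e5(2) d(5) that by (auto simp: subset_iff)
  have tI: "t \<in> I" "t \<in> J" if "\<bar>t\<bar> < d" for t
    using tD[OF that] D(3) J(3) by auto
  have XK: "norm (X t) \<le> K" if "\<bar>t\<bar> < d" for t using K(3) that d(4) by simp
  have hom\<Psi>: "lie_hom \<gamma> \<gamma> (\<Psi> t)" if "\<bar>t\<bar> < d" for t
  proof (rule derivation_flow_lie_hom[where d = d and K = K and X = X])
    show "(\<Psi> has_vector_derivative X s o\<^sub>L \<Psi> s) (at s)" if "\<bar>s\<bar> < d" for s
      using d1(3) D(4) tD[OF that] by blast
    show "X s (\<gamma> x y) = \<gamma> (X s x) y + \<gamma> x (X s y)" if "\<bar>s\<bar> < d" for s x y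
      using der tI(1)[OF that] by blast
  qed (use d1 d K XK that in auto)
  have comm: "\<iota>t t (\<psi> t x) = \<Psi> t (\<iota> x)" if t: "\<bar>t\<bar> < d" for t x
  proof -
    let ?w = "\<lambda>t. \<iota>t t (\<psi> t x) - \<Psi> t (\<iota> x)"
    have "?w t = 0"
    proof (rule linear_ODE_solution_unique[where w' = "\<lambda>t. X t (?w t)"])
      fix s assume s: "\<bar>s\<bar> < d"
      have "(?w has_vector_derivative
          (\<iota>t s ((\<theta> s o\<^sub>L \<psi> s) x) + ?\<iota>' s (\<psi> s x)) - (X s o\<^sub>L \<Psi> s) (\<iota> x)) (at s)"
        using tI[OF s] tD[OF s] D(4,5)
        by (intro has_vector_derivative_diff blinfun.has_vector_derivative
            has_vector_derivative_blinfun_apply_const d1(3) d2(3)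
            smooth_family_has_vector_derivative[OF I(1) \<iota>t(1)]) auto
      then show "(?w has_vector_derivative X s (?w s)) (at s)"
        by (simp add: \<theta>[OF tI(2)[OF s]] blinfun.diff_right)
      show "norm (X s (?w s)) \<le> K * norm (?w s)"
        using norm_blinfun[of "X s" "?w s"] mult_right_mono[OF XK[OF s] norm_ge_zero[of "?w s"]] by linarith
    qed (use K d t d1(2) d2(2) \<iota>t(2) in auto)
    then show ?thesis by simp
  qed
  have hom\<psi>: "lie_hom \<mu> (\<mu>t t) (\<psi> t)" if t: "\<bar>t\<bar> < d" for t
    unfolding lie_hom_def
  proof (intro allI)
    fix x y
    have "\<iota>t t (\<psi> t (\<mu> x y)) = \<gamma> (\<Psi> t (\<iota> x)) (\<Psi> t (\<iota> y))"
      using comm[OF t] \<iota>(1) hom\<Psi>[OF t] by (simp add: lie_hom_def)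
    also have "\<dots> = \<iota>t t (\<mu>t t (\<psi> t x) (\<psi> t y))"
      using comm[OF t] \<iota>t(3)[OF tI(1)[OF t]] by (simp add: lie_hom_def)
    finally show "\<psi> t (\<mu> x y) = \<mu>t t (\<psi> t x) (\<psi> t y)"
      using \<iota>t(4)[OF tI(1)[OF t]] by (simp add: inj_eq)
  qed
  define I' where "I' = {-d<..<d}"
  have I': "\<And>t. t \<in> I' \<Longrightarrow> \<bar>t\<bar> < d" by (auto simp: I'_def)
  have GL': "\<Psi> t \<in> GL" "\<psi> t \<in> GL" if "t \<in> I'" for t
    using e2(2) e3(2) d I'[OF that] by auto
  have "Aut_trivial I' \<gamma> \<mu> \<iota> \<mu>t \<iota>t"
    unfolding Aut_trivial_def
  proof (intro exI conjI ballI)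
    have "I' \<subseteq> D" using tD I' by blast
    then show "smooth_family I' \<psi>" "smooth_family I' \<Psi>"
      using sm\<psi> sm\<Psi> smooth_family_subset by blast+
    fix t assume t: "t \<in> I'"
    show "\<psi> t \<in> GL" "\<Psi> t \<in> lie_Aut \<gamma>" "lie_iso \<mu> (\<mu>t t) (\<psi> t)"
      using GL'[OF t] hom\<Psi>[OF I'[OF t]] hom\<psi>[OF I'[OF t]]
      by (auto simp: lie_Aut_def lie_iso_def GL_def)
    show "\<iota>t t o\<^sub>L \<psi> t = \<Psi> t o\<^sub>L \<iota>"
      by (intro blinfun_eqI) (simp add: comm[OF I'[OF t]])
  qed (fact d1(2) d2(2))+
  moreover have "I' \<subseteq> I" using tI(1) I' by blast
  moreover have "open_interval I'" "0 \<in> I'"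
    using d(1) by (auto simp: I'_def open_interval_def is_interval_oo)
  ultimately show ?thesis by blast
qed

theorem theorem2p2:
  fixes \<gamma> :: "'g::finite_dim_space bracket"
    and \<mu> :: "'h::finite_dim_space bracket"
    and \<iota> :: "'h \<Rightarrow>\<^sub>L 'g"
    and I :: "real set"
    and \<mu>t :: "real \<Rightarrow> 'h bracket"
    and \<iota>t :: "real \<Rightarrow> 'h \<Rightarrow>\<^sub>L 'g"
  defines "\<pi> \<equiv> \<lambda>t. quot_proj (range (blinfun_apply (\<iota>t t)))"
    and "\<iota>dot \<equiv> \<lambda>t. vector_derivative \<iota>t (at t)"
  assumes "lie_bracket \<gamma>" and "lie_bracket \<mu>"
    and "lie_hom \<mu> \<gamma> \<iota>" and "inj (blinfun_apply \<iota>)"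
    and "open_interval I" and "0 \<in> I"
    and "lie_subalgebra_deformation I \<gamma> \<mu> \<iota> \<mu>t \<iota>t"
  shows "(\<forall>t\<in>I. cochain1 (\<pi> t \<circ> blinfun_apply (\<iota>dot t))
             \<in> CE_cocycles 1 (\<mu>t t) (quotient_module \<gamma> (\<iota>t t))) \<and>
         (Aut_trivial I \<gamma> \<mu> \<iota> \<mu>t \<iota>t \<longrightarrow>
           (\<exists>X :: real \<Rightarrow> 'g \<Rightarrow>\<^sub>L 'g.
              smooth_family I X \<and>
              (\<forall>t\<in>I. cochain1 (blinfun_apply (X t)) \<in> CE_cocycles 1 \<gamma> (adjoint_module \<gamma>)) \<and>
              (\<forall>t\<in>I. \<pi> t \<circ> blinfun_apply (\<iota>dot t) = \<pi> t \<circ> blinfun_apply (X t o\<^sub>L \<iota>t t)))) \<and>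
         ((\<exists>X :: real \<Rightarrow> 'g \<Rightarrow>\<^sub>L 'g.
              smooth_family I X \<and>
              (\<forall>t\<in>I. cochain1 (blinfun_apply (X t)) \<in> CE_cocycles 1 \<gamma> (adjoint_module \<gamma>)) \<and>
              (\<forall>t\<in>I. \<pi> t \<circ> blinfun_apply (\<iota>dot t) = \<pi> t \<circ> blinfun_apply (X t o\<^sub>L \<iota>t t))) \<longrightarrow>
           (\<exists>I'. I' \<subseteq> I \<and> open_interval I' \<and> 0 \<in> I' \<and> Aut_trivial I' \<gamma> \<mu> \<iota> \<mu>t \<iota>t))"
proof -
  have I: "open I" using assms(7) by (simp add: open_interval_def)
  have \<mu>t: "smooth_family I \<mu>t" and \<iota>t: "smooth_family I \<iota>t"
    and hom: "\<And>t. t \<in> I \<Longrightarrow> lie_hom (\<mu>t t) \<gamma> (\<iota>t t)"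
    using assms(9) by (auto simp: lie_subalgebra_deformation_def lie_algebra_deformation_def)
  have cocycle: "cochain1 (\<pi> t \<circ> blinfun_apply (\<iota>dot t))
      \<in> CE_cocycles 1 (\<mu>t t) (quotient_module \<gamma> (\<iota>t t))" if t: "t \<in> I" for t
    unfolding \<pi>_def \<iota>dot_def cochain1_quotient_cocycle_iff[OF hom[OF t]]
  proof (intro allI)
    fix x y
    let ?\<iota>' = "vector_derivative \<iota>t (at t)"
    let ?\<mu>' = "vector_derivative \<mu>t (at t)"
    have "\<iota>t t (?\<mu>' x y) + ?\<iota>' (\<mu>t t x y) = \<gamma> (\<iota>t t x) (?\<iota>' y) + \<gamma> (?\<iota>' x) (\<iota>t t y)"
      by (rule derivative_of_lie_homs[OF I t hom])
        (auto intro: smooth_family_has_vector_derivative[OF I] \<mu>t \<iota>t t)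
    then have "\<gamma> (\<iota>t t x) (?\<iota>' y) - \<gamma> (\<iota>t t y) (?\<iota>' x) - ?\<iota>' (\<mu>t t x y) = \<iota>t t (?\<mu>' x y)"
      by (simp add: bracket_antisym[OF assms(3), of "?\<iota>' x"] algebra_simps)
    then show "\<gamma> (\<iota>t t x) (?\<iota>' y) - \<gamma> (\<iota>t t y) (?\<iota>' x) - ?\<iota>' (\<mu>t t x y) \<in> range (blinfun_apply (\<iota>t t))"
      by (rule range_eqI)
  qed
  have X_iff: "(\<forall>t\<in>I. cochain1 (blinfun_apply (X t)) \<in> CE_cocycles 1 \<gamma> (adjoint_module \<gamma>)) \<and>
      (\<forall>t\<in>I. \<pi> t \<circ> blinfun_apply (\<iota>dot t) = \<pi> t \<circ> blinfun_apply (X t o\<^sub>L \<iota>t t)) \<longleftrightarrow>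
    (\<forall>t\<in>I. \<forall>x y. X t (\<gamma> x y) = \<gamma> (X t x) y + \<gamma> x (X t y)) \<and>
      (\<forall>t\<in>I. \<forall>x. \<iota>dot t x - X t (\<iota>t t x) \<in> range (blinfun_apply (\<iota>t t)))"
    for X :: "real \<Rightarrow> 'g \<Rightarrow>\<^sub>L 'g"
    unfolding derivation_iff_cocycle[OF assms(3)] \<pi>_def quot_proj_comp_eq_iff
      blinfun_apply_blinfun_compose ..
  show ?thesis
    unfolding X_iff
  proof (intro conjI ballI impI)
    assume "Aut_trivial I \<gamma> \<mu> \<iota> \<mu>t \<iota>t"
    then show "\<exists>X :: real \<Rightarrow> 'g \<Rightarrow>\<^sub>L 'g. smooth_family I X \<and>
      (\<forall>t\<in>I. \<forall>x y. blinfun_apply (X t) (\<gamma> x y) =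
        \<gamma> (blinfun_apply (X t) x) y + \<gamma> x (blinfun_apply (X t) y)) \<and>
      (\<forall>t\<in>I. \<forall>x. \<iota>dot t x - blinfun_apply (X t) (\<iota>t t x) \<in> range (blinfun_apply (\<iota>t t)))"
      unfolding \<iota>dot_def by (rule Aut_trivial_imp_derivations[OF I \<iota>t])
  next
    assume "\<exists>X :: real \<Rightarrow> 'g \<Rightarrow>\<^sub>L 'g. smooth_family I X \<and>
      (\<forall>t\<in>I. \<forall>x y. blinfun_apply (X t) (\<gamma> x y) =
        \<gamma> (blinfun_apply (X t) x) y + \<gamma> x (blinfun_apply (X t) y)) \<and>
      (\<forall>t\<in>I. \<forall>x. \<iota>dot t x - blinfun_apply (X t) (\<iota>t t x) \<in> range (blinfun_apply (\<iota>t t)))"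
    then obtain X :: "real \<Rightarrow> 'g \<Rightarrow>\<^sub>L 'g" where X: "smooth_family I X"
      "\<forall>t\<in>I. \<forall>x y. X t (\<gamma> x y) = \<gamma> (X t x) y + \<gamma> x (X t y)"
      "\<forall>t\<in>I. \<forall>x. \<iota>dot t x - X t (\<iota>t t x) \<in> range (blinfun_apply (\<iota>t t))"
      by (elim exE conjE)
    show "\<exists>I'\<subseteq>I. open_interval I' \<and> 0 \<in> I' \<and> Aut_trivial I' \<gamma> \<mu> \<iota> \<mu>t \<iota>t"
      using X(2,3) unfolding \<iota>dot_def
      by (intro derivations_imp_Aut_trivial[OF I assms(8,5,6,9) X(1)]) auto
  qed (rule cocycle)
qed

end
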